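(* Fix any $m\ge3$, $\sigma\in\mathcal{S}_m$, $q>0$, $n\ge 2m-1$, and let $N_n(\sigma,q)$ denote the number of occurrences of $\sigma$ in a random permutation of length $n$ drawn from the Mallows($q$) distribution. For $1\le s\le m-1$ define $$\mu(\sigma,q):=\frac{q^{\operatorname{inv}(\sigma)}}{[m]_q!},\qquad a_n(\sigma,q):=(n-m+1)\mu(\sigma,q),\qquad T(s,\sigma,q):=\sum_{\tau\in\mathrm{Ov}_s(\sigma)}\frac{q^{\operatorname{inv}(\tau)}}{[2m-s]_q!},$$ $$b_n(\sigma,q)^2:=(n-m+1)\mu(\sigma,q)(1-\mu(\sigma,q))+2\sum_{s=1}^{m-1}(n-2m+1+s)\left(T(s,\sigma,q)-\mu(\sigma,q)^2\right),$$ $$\theta_n(\sigma,q):=\frac{\mu(\sigma,q)(1-\mu(\sigma,q))^3+(1-\mu(\sigma,q))\mu(\sigma,q)^3}{b_n(\sigma,q)^3}.$$ Then $$\sup_k\left|\mathbb{P}(N_n(\sigma,q)\le k)-\mathbb{P}\left(Z\le\frac{k-a_n(\sigma,q)}{b_n(\sigma,q)}\right)\right|\le 75\,(10(m-1)+1)^2\,(n-m+1)\,\theta_n(\sigma,q),$$ where $Z$ is a standard Gaussian random variable (mean $0$, variance $1$).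
   Context: For $q>0$, the Mallows($q$) distribution on $\mathcal{S}_n$ (permutations of $[n]$) gives $\pi$ probability $q^{\operatorname{inv}(\pi)}/[n]_q!$, where $\operatorname{inv}(\pi)$ is the number of pairs $i<j$ with $\pi_i>\pi_j$, $[n]_q=1+q+\dots+q^{n-1}$, $[n]_q!=[1]_q\cdots[n]_q$. For distinct integers $w=w_1\dots w_k$, $\operatorname{st}(w)$ is the permutation of $[k]$ order-isomorphic to $w$. The number of occurrences of $\sigma\in\mathcal{S}_m$ in $\pi\in\mathcal{S}_n$ is the number of $j\in[n-m+1]$ with $\operatorname{st}(\pi_j\pi_{j+1}\dots\pi_{j+m-1})=\sigma$. For $1\le s\le m-1$, the overlap set $\mathrm{Ov}_s(\sigma)$ is the set of $\tau\in\mathcal{S}_{2m-s}$ with $\operatorname{st}(\tau_1\cdots\tau_m)=\operatorname{st}(\tau_{m-s+1}\cdots\tau_{2m-s})=\sigma$. *)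

theory Defs
  imports "HOL-Probability.Probability" "HOL-Combinatorics.Multiset_Permutations"
begin

text \<open>
  Permutations are lists in one-line notation, with entries in \<open>{1..n}\<close>. Entries are 1-based,
  but list positions are 0-based: the letter \<open>\<pi>\<^sub>i\<close> is \<open>\<pi> ! (i - 1)\<close>.
\<close>

abbreviation Sym :: "nat \<Rightarrow> nat list set" where
  "Sym n \<equiv> permutations_of_set {1..n}"

definition inversions :: "nat list \<Rightarrow> nat" where
  "inversions w = card {(i, j). i < j \<and> j < length w \<and> w ! i > w ! j}"

definition qint :: "real \<Rightarrow> nat \<Rightarrow> real" where
  "qint q n = (\<Sum>i<n. q ^ i)"

definition qfact :: "real \<Rightarrow> nat \<Rightarrow> real" where
  "qfact q n = (\<Prod>k=1..n. qint q k)"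

text \<open>
  For \<open>q > 0\<close> the weights are nonnegative and sum to 1, so that \<^const>\<open>embed_pmf\<close> yields
  the distribution with exactly these weights; see \<open>pmf_mallows\<close> below.
\<close>

definition mallows :: "nat \<Rightarrow> real \<Rightarrow> nat list pmf" where
  "mallows n q =
     embed_pmf (\<lambda>\<pi>. if \<pi> \<in> Sym n then q ^ inversions \<pi> / qfact q n else 0)"

text \<open>Standardization replaces every entry of a word of distinct numbers by its rank.\<close>

definition st :: "nat list \<Rightarrow> nat list" where
  "st w = map (\<lambda>x. card {y \<in> set w. y \<le> x}) w"

text \<open>The factor of \<open>w\<close> with \<open>m\<close> letters that starts at the 0-based position \<open>j\<close>.\<close>

definition factor :: "nat \<Rightarrow> nat \<Rightarrow> nat list \<Rightarrow> nat list" where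
  "factor j m w = take m (drop j w)"

definition occurrences :: "nat list \<Rightarrow> nat list \<Rightarrow> nat" where
  "occurrences \<sigma> \<pi> =
     card {j. j + length \<sigma> \<le> length \<pi> \<and> st (factor j (length \<sigma>) \<pi>) = \<sigma>}"

definition Ov :: "nat \<Rightarrow> nat list \<Rightarrow> nat list set" where
  "Ov s \<sigma> = (let m = length \<sigma> in
     {\<tau> \<in> Sym (2 * m - s). st (factor 0 m \<tau>) = \<sigma> \<and> st (factor (m - s) m \<tau>) = \<sigma>})"

definition mu :: "nat list \<Rightarrow> real \<Rightarrow> real" where
  "mu \<sigma> q = q ^ inversions \<sigma> / qfact q (length \<sigma>)"

definition a_mean :: "nat \<Rightarrow> nat list \<Rightarrow> real \<Rightarrow> real" where
  "a_mean n \<sigma> q = (real n - real (length \<sigma>) + 1) * mu \<sigma> q"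

definition T :: "nat \<Rightarrow> nat list \<Rightarrow> real \<Rightarrow> real" where
  "T s \<sigma> q = (\<Sum>\<tau>\<in>Ov s \<sigma>. q ^ inversions \<tau> / qfact q (2 * length \<sigma> - s))"

definition b_sq :: "nat \<Rightarrow> nat list \<Rightarrow> real \<Rightarrow> real" where
  "b_sq n \<sigma> q = (let m = length \<sigma> in
     (real n - real m + 1) * mu \<sigma> q * (1 - mu \<sigma> q)
     + 2 * (\<Sum>s=1..m-1. (real n - 2 * real m + 1 + real s) * (T s \<sigma> q - (mu \<sigma> q)\<^sup>2)))"

definition b_dev :: "nat \<Rightarrow> nat list \<Rightarrow> real \<Rightarrow> real" where
  "b_dev n \<sigma> q = sqrt (b_sq n \<sigma> q)"

definition theta :: "nat \<Rightarrow> nat list \<Rightarrow> real \<Rightarrow> real" where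
  "theta n \<sigma> q =
     (mu \<sigma> q * (1 - mu \<sigma> q) ^ 3 + (1 - mu \<sigma> q) * mu \<sigma> q ^ 3) / b_dev n \<sigma> q ^ 3"

lemma card_rank_less_bij:
  fixes A :: "nat set"
  assumes "finite A"
  shows "bij_betw (\<lambda>x. card {y \<in> A. y < x}) A {..<card A}"
proof -
  let ?r = "\<lambda>x. card {y \<in> A. y < x}"
  have mono: "?r x < ?r y" if "x \<in> A" "y \<in> A" "x < y" for x y
  proof (rule psubset_card_mono)
    have "x \<in> {z \<in> A. z < y}" "x \<notin> {z \<in> A. z < x}"
      using that by simp_all
    moreover have "{z \<in> A. z < x} \<subseteq> {z \<in> A. z < y}"
      using that by (simp add: Collect_mono_iff)
    ultimately show "{z \<in> A. z < x} \<subset> {z \<in> A. z < y}"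
      by blast
  qed (simp add: assms)
  have inj: "inj_on ?r A"
  proof (rule inj_onI)
    fix x y assume "x \<in> A" "y \<in> A" "?r x = ?r y"
    then show "x = y"
      using mono[of x y] mono[of y x] by (cases x y rule: linorder_cases) simp_all
  qed
  have "?r x < card A" if "x \<in> A" for x
    using that assms by (intro psubset_card_mono) blast+
  then have "?r ` A \<subseteq> {..<card A}"
    by auto
  then have "?r ` A = {..<card A}"
    using inj by (intro card_subset_eq) (auto simp: card_image)
  then show ?thesis
    using inj by (simp add: bij_betw_def)
qed

lemma card_rank_le_bij:
  fixes A :: "nat set"
  assumes "finite A"
  shows "bij_betw (\<lambda>x. card {y \<in> A. y \<le> x}) A {1..card A}"
proof -
  have eq: "card {y \<in> A. y \<le> x} = Suc (card {y \<in> A. y < x})" if "x \<in> A" for x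
  proof -
    have "{y \<in> A. y \<le> x} = insert x {y \<in> A. y < x}"
      using that by auto
    then show ?thesis
      using assms by simp
  qed
  have "bij_betw (Suc \<circ> (\<lambda>x. card {y \<in> A. y < x})) A {1..card A}"
    by (rule bij_betw_trans[OF card_rank_less_bij[OF assms]])
       (simp add: bij_betw_def image_Suc_lessThan)
  then show ?thesis
    unfolding comp_def by (rule iffD1[OF bij_betw_cong, rotated]) (rule eq[symmetric])
qed

lemma st_in_Sym:
  assumes "distinct w"
  shows "st w \<in> Sym (length w)"
proof (rule permutations_of_setI)
  let ?r = "\<lambda>x. card {y \<in> set w. y \<le> x}"
  have bij: "bij_betw ?r (set w) {1..card (set w)}"
    by (rule card_rank_le_bij) simp
  show "set (st w) = {1..length w}"
    unfolding st_def set_map bij_betw_imp_surj_on[OF bij] distinct_card[OF assms] ..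
  show "distinct (st w)"
    unfolding st_def distinct_map using assms bij_betw_imp_inj_on[OF bij] by blast
qed

lemma st_order_iso:
  assumes "i < length w" "j < length w"
  shows "st w ! i < st w ! j \<longleftrightarrow> w ! i < w ! j"
proof -
  let ?S = "\<lambda>x. {y \<in> set w. y \<le> x}"
  have nth: "st w ! i = card (?S (w ! i))" "st w ! j = card (?S (w ! j))"
    using assms by (simp_all add: st_def)
  show ?thesis
  proof (cases "w ! i < w ! j")
    case True
    have "w ! j \<in> ?S (w ! j)" "w ! j \<notin> ?S (w ! i)"
      using True nth_mem[OF assms(2)] by simp_all
    moreover have "?S (w ! i) \<subseteq> ?S (w ! j)"
      using True by (simp add: Collect_mono_iff)
    ultimately have "?S (w ! i) \<subset> ?S (w ! j)"
      by blast
    then have "card (?S (w ! i)) < card (?S (w ! j))"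
      by (rule psubset_card_mono[rotated]) simp
    with True nth show ?thesis
      by simp
  next
    case False
    then have "?S (w ! j) \<subseteq> ?S (w ! i)"
      by (simp add: Collect_mono_iff)
    then have "card (?S (w ! j)) \<le> card (?S (w ! i))"
      by (rule card_mono[rotated]) simp
    with False nth show ?thesis
      by simp
  qed
qed

lemma inversions_Nil [simp]: "inversions [] = 0"
  by (simp add: inversions_def)

lemma inversions_Cons:
  assumes "distinct (x # xs)"
  shows "inversions (x # xs) = card {y \<in> set xs. y < x} + inversions xs"
proof -
  let ?J = "{j. j < length xs \<and> xs ! j < x}"
  let ?I = "{(i, j). i < j \<and> j < length xs \<and> xs ! i > xs ! j}"
  have fin: "finite ?I"
    by (rule finite_subset[of _ "{..<length xs} \<times> {..<length xs}"]) auto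
  have "{(i, j). i < j \<and> j < length (x # xs) \<and> (x # xs) ! i > (x # xs) ! j}
        = (\<lambda>j. (0, Suc j)) ` ?J \<union> map_prod Suc Suc ` ?I" (is "?L = ?R")
  proof (rule set_eqI)
    fix p :: "nat \<times> nat"
    obtain i j where "p = (i, j)"
      by fastforce
    then show "p \<in> ?L \<longleftrightarrow> p \<in> ?R"
      by (cases i; cases j) (simp_all add: image_iff split_beta)
  qed
  then have "inversions (x # xs) = card ((\<lambda>j. (0::nat, Suc j)) ` ?J \<union> map_prod Suc Suc ` ?I)"
    by (simp add: inversions_def)
  also have "\<dots> = card ((\<lambda>j. (0::nat, Suc j)) ` ?J) + card (map_prod Suc Suc ` ?I)"
    using fin by (intro card_Un_disjoint) auto
  also have "card ((\<lambda>j. (0::nat, Suc j)) ` ?J) = card ?J"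
    by (intro card_image) (auto simp: inj_on_def)
  also have "card (map_prod Suc Suc ` ?I) = inversions xs"
    unfolding inversions_def by (intro card_image inj_onI) (simp add: prod_eq_iff)
  also have "card ?J = card ((!) xs ` ?J)"
    using assms by (intro card_image[symmetric]) (auto simp: inj_on_def nth_eq_iff_index_eq)
  also have "(!) xs ` ?J = {y \<in> set xs. y < x}"
    by (auto simp: in_set_conv_nth)
  finally show ?thesis .
qed

lemma sum_inversions:
  assumes "finite A"
  shows "(\<Sum>w\<in>permutations_of_set A. q ^ inversions w) = qfact q (card A)"
  using assms
proof (induction "card A" arbitrary: A)
  case 0
  then show ?case
    by (simp add: qfact_def)
next
  case (Suc n)
  then have ne: "A \<noteq> {}"
    by auto
  have "(\<Sum>w\<in>permutations_of_set A. q ^ inversions w)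
        = (\<Sum>x\<in>A. \<Sum>w\<in>(#) x ` permutations_of_set (A - {x}). q ^ inversions w)"
    unfolding permutations_of_set_nonempty[OF ne]
    using Suc.prems by (intro sum.UNION_disjoint) auto
  also have "\<dots> = (\<Sum>x\<in>A. q ^ card {y \<in> A. y < x} * qfact q n)"
  proof (rule sum.cong[OF refl])
    fix x assume x: "x \<in> A"
    have "(\<Sum>w\<in>(#) x ` permutations_of_set (A - {x}). q ^ inversions w)
          = (\<Sum>w\<in>permutations_of_set (A - {x}). q ^ inversions (x # w))"
      by (subst sum.reindex) auto
    also have "\<dots> = (\<Sum>w\<in>permutations_of_set (A - {x}).
                      q ^ card {y \<in> A. y < x} * q ^ inversions w)"
    proof (rule sum.cong[OF refl])
      fix w assume "w \<in> permutations_of_set (A - {x})"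
      then have w: "set w = A - {x}" "distinct w"
        by (auto dest: permutations_of_setD)
      have "{y \<in> set w. y < x} = {y \<in> A. y < x}"
        using w by auto
      then show "q ^ inversions (x # w) = q ^ card {y \<in> A. y < x} * q ^ inversions w"
        using w by (simp add: inversions_Cons power_add)
    qed
    also have "\<dots> = q ^ card {y \<in> A. y < x} * qfact q n"
    proof -
      have n: "card (A - {x}) = n"
        using Suc.hyps(2) Suc.prems x by simp
      then have "(\<Sum>w\<in>permutations_of_set (A - {x}). q ^ inversions w) = qfact q n"
        using Suc.hyps(1)[of "A - {x}"] Suc.prems by simp
      then show ?thesis
        by (simp add: sum_distrib_left[symmetric])
    qed
    finally show "(\<Sum>w\<in>(#) x ` permutations_of_set (A - {x}). q ^ inversions w)
                  = q ^ card {y \<in> A. y < x} * qfact q n" .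
  qed
  also have "\<dots> = (\<Sum>x\<in>A. q ^ card {y \<in> A. y < x}) * qfact q n"
    by (simp add: sum_distrib_right)
  also have "(\<Sum>x\<in>A. q ^ card {y \<in> A. y < x}) = qint q (card A)"
    unfolding qint_def
    by (rule sum.reindex_bij_betw[OF card_rank_less_bij[OF Suc.prems]])
  also have "qint q (card A) * qfact q n = qfact q (card A)"
    by (simp add: qfact_def Suc.hyps(2)[symmetric])
  finally show ?case .
qed

lemma qfact_pos:
  assumes "q > 0"
  shows "qfact q n > 0"
  unfolding qfact_def qint_def using assms
  by (intro prod_pos ballI sum_pos) (auto simp: lessThan_empty_iff)

lemma pmf_mallows:
  assumes "q > 0"
  shows "pmf (mallows n q) \<pi> = (if \<pi> \<in> Sym n then q ^ inversions \<pi> / qfact q n else 0)"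
proof -
  let ?f = "\<lambda>\<pi>. if \<pi> \<in> Sym n then q ^ inversions \<pi> / qfact q n else 0"
  have nonneg: "?f w \<ge> 0" for w
    using assms qfact_pos[OF assms, of n] by simp
  have "(\<integral>\<^sup>+w. ennreal (?f w) \<partial>count_space UNIV) = (\<Sum>w\<in>Sym n. ennreal (?f w))"
    by (rule nn_integral_count_space') auto
  also have "\<dots> = ennreal (\<Sum>w\<in>Sym n. ?f w)"
    by (rule sum_ennreal) (rule nonneg)
  also have "(\<Sum>w\<in>Sym n. ?f w) = (\<Sum>w\<in>Sym n. q ^ inversions w) / qfact q n"
    by (simp add: sum_divide_distrib)
  also have "\<dots> = 1"
    using sum_inversions[of "{1..n}" q] qfact_pos[OF assms, of n] by simp
  finally have "(\<integral>\<^sup>+w. ennreal (?f w) \<partial>count_space UNIV) = 1"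
    by simp
  then show ?thesis
    unfolding mallows_def using nonneg by (subst pmf_embed_pmf) auto
qed

end

theory Submission
  imports Defs
begin

text \<open>
  Cutting a Mallows permutation at a position yields two words whose standardizations are
  independent Mallows permutations, since the inversions across the cut depend only on the set of
  letters to the left of it. Hence the indicators of an occurrence at the successive positions are
  \<open>(m - 1)\<close>-dependent, and \<open>b_sq\<close> is the variance of their sum.

  For a normalized sum \<open>W\<close> of centred \<open>d\<close>-dependent variables bounded by \<open>A\<close>, with second moments
  summing to \<open>V\<close>, Stein's method applied to an indicator smoothed over an interval of length
  proportional to \<open>B = (2d + 1)\<^sup>2 V A\<close> bounds the distance \<open>\<delta>\<close> to the normal distribution by
  \<open>14 B + \<delta> / 2\<close>: the probability that \<open>W\<close> falls into a short interval is itself estimated by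
  \<open>2 \<delta>\<close> plus the length of the interval. This gives \<open>\<delta> \<le> 28 B\<close>, which suffices because a centred
  indicator divided by \<open>b\<close> satisfies \<open>A = 1 / b\<close> and its third absolute moment is at least \<open>A / 2\<close>
  times the second.
\<close>

section \<open>Stein equation for the normal distribution\<close>

lemma has_real_derivative_std_normal_density:
  "(std_normal_density has_real_derivative (- x * std_normal_density x)) (at x)"
  unfolding std_normal_density_def [abs_def]
  by (auto intro!: derivative_eq_intros simp: field_simps)

lemma std_normal_density_le_half: "std_normal_density x \<le> 1 / 2"
proof -
  have "2 \<le> sqrt (2 * pi)"
    using pi_gt3 by (intro real_le_rsqrt) simp
  then have "1 / sqrt (2 * pi) \<le> 1 / 2"
    by (intro divide_left_mono) auto
  then have "(1 / sqrt (2 * pi)) * exp (- x\<^sup>2 / 2) \<le> (1 / 2) * 1"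
    by (intro mult_mono) auto
  then show ?thesis
    by (simp add: std_normal_density_def)
qed

text \<open>The factor 1/2 is the bound on the density. The estimate is used twice: for the cost of
  replacing an indicator by a ramp, and for the normal probability of a short interval.\<close>

lemma cdf_std_normal_diff_le:
  assumes "x \<le> y"
  shows "cdf std_normal_distribution y - cdf std_normal_distribution x \<le> (y - x) / 2"
proof (cases "x = y")
  case False
  with assms have less: "x < y" by simp
  interpret real_distribution std_normal_distribution
    by (rule real_dist_normal_dist)
  have "cdf std_normal_distribution y - cdf std_normal_distribution x
      = measure std_normal_distribution {x<..y}"
    using less by (rule cdf_diff_eq)
  also have "\<dots> = (LINT t|std_normal_distribution. indicator {x<..y} t)"
    by simp
  also have "\<dots> = (LINT t|lborel. std_normal_density t * indicator {x<..y} t)"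
    by (subst integral_density) auto
  also have "\<dots> \<le> (LINT t|lborel. (1 / 2) * indicator {x<..y} t)"
  proof (rule integral_mono)
    show "integrable lborel (\<lambda>t. std_normal_density t * indicator {x<..y} t)"
      by (intro integrable_real_mult_indicator) auto
    show "integrable lborel (\<lambda>t. (1 / 2) * indicator {x<..y} t :: real)"
      using less by simp
  qed (use std_normal_density_le_half in \<open>auto simp: indicator_def\<close>)
  also have "\<dots> = (y - x) / 2"
    using less by simp
  finally show ?thesis .
qed simp

text \<open>A Mills ratio argument. With \<phi> the normal density, \<phi>(y)/y falls at the rate (1
  + 1/y^2) \<phi>(y), which is at least |k(y)| \<phi>(y). So \<phi>(y)/y - s G(y) is nonincreasing
  for y > 0 and tends to 0, hence is nonnegative; s = 1 and s = -1 give the two halves of the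
  absolute value.\<close>

lemma gaussian_tail_bound:
  fixes G k :: "real \<Rightarrow> real"
  assumes deriv: "\<And>x. (G has_real_derivative k x * std_normal_density x) (at x)"
    and k: "\<And>x. \<bar>k x\<bar> \<le> 1"
    and lim: "(G \<longlongrightarrow> 0) at_top"
    and "x > 0"
  shows "\<bar>G x\<bar> \<le> std_normal_density x / x"
proof -
  have tail: "s * G x \<le> std_normal_density x / x" if s: "\<bar>s\<bar> = 1" for s
  proof -
    define u where "u y = std_normal_density y / y - s * G y" for y
    have du: "(u has_real_derivative
        (std_normal_density y * (- 1 - 1 / y\<^sup>2 - s * k y))) (at y)" if "y > 0" for y
      unfolding u_def using that
      by (auto intro!: derivative_eq_intros has_real_derivative_std_normal_density deriv
               simp: field_simps power2_eq_square)
    have u_mono: "u y \<le> u x" if "y \<ge> x" for y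
    proof (rule DERIV_nonpos_imp_nonincreasing[OF that])
      fix z assume z: "x \<le> z" "z \<le> y"
      have "\<bar>s * k z\<bar> \<le> 1"
        using k[of z] s by (simp add: abs_mult)
      then have "- 1 - 1 / z\<^sup>2 - s * k z \<le> 0"
        by (smt (verit) zero_le_divide_1_iff zero_le_power2)
      then have "std_normal_density z * (- 1 - 1 / z\<^sup>2 - s * k z) \<le> 0"
        by (simp add: mult_nonneg_nonpos)
      then show "\<exists>D. (u has_real_derivative D) (at z) \<and> D \<le> 0"
        using du[of z] z \<open>x > 0\<close> by (meson order_less_le_trans)
    qed
    have "((\<lambda>y. std_normal_density y / y) \<longlongrightarrow> 0) at_top"
    proof (rule tendsto_sandwich[where f = "\<lambda>_. 0" and h = "\<lambda>y. (1 / 2) / y"])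
      show "\<forall>\<^sub>F y in at_top. 0 \<le> std_normal_density y / y"
        using eventually_gt_at_top[of 0] by eventually_elim simp
      show "\<forall>\<^sub>F y in at_top. std_normal_density y / y \<le> (1 / 2) / y"
        using eventually_gt_at_top[of 0]
        by eventually_elim (intro divide_right_mono std_normal_density_le_half, simp)
      show "((\<lambda>y::real. (1 / 2) / y) \<longlongrightarrow> 0) at_top"
        by (intro tendsto_divide_0[OF tendsto_const] filterlim_at_top_imp_at_infinity filterlim_ident)
    qed simp
    then have "(u \<longlongrightarrow> 0 - s * 0) at_top"
      unfolding u_def by (intro tendsto_intros lim)
    then have "0 \<le> u x"
      using eventually_mono[OF eventually_ge_at_top[of x] u_mono]
      by (intro tendsto_upperbound[of u 0 at_top]) auto
    then show ?thesis
      by (simp add: u_def)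
  qed
  show ?thesis
    using tail[of 1] tail[of "-1"] by simp
qed

text \<open>The solution is f = G/\<phi>, where \<phi> is the normal density and G(x) is the
  integral of (h - c) \<phi> up to x. Centring by c makes G vanish at both ends, so the tail bound
  yields |x f(x)| <= 1, and the equation then bounds the derivative by 1 + 1. Continuity of h makes
  the equation hold at every point.\<close>

lemma stein_solution_exists:
  fixes h :: "real \<Rightarrow> real"
  assumes cont: "continuous_on UNIV h" and h: "\<And>x. 0 \<le> h x" "\<And>x. h x \<le> 1"
  defines "c \<equiv> (LINT t|std_normal_distribution. h t)"
  obtains f where
    "\<And>x. (f has_real_derivative x * f x + (h x - c)) (at x)"
    "\<And>x. \<bar>x * f x + (h x - c)\<bar> \<le> 2"
    "\<And>x. \<bar>f x\<bar> \<le> 3"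
proof -
  interpret real_distribution std_normal_distribution
    by (rule real_dist_normal_dist)
  have hm [measurable]: "h \<in> borel_measurable borel"
    using cont by (rule borel_measurable_continuous_onI)
  have hint: "integrable std_normal_distribution h"
    by (rule integrable_const_bound[of _ 1]) (use h in auto)
  have c: "0 \<le> c" "c \<le> 1"
    unfolding c_def using hint h by (auto intro!: Bochner_Integration.integral_nonneg integral_le_const)
  define k where "k x = h x - c" for x
  have km [measurable]: "k \<in> borel_measurable borel"
    unfolding k_def [abs_def] by measurable
  have k: "\<bar>k x\<bar> \<le> 1" for x
    using h[of x] c by (auto simp: k_def abs_if)
  define g where "g x = k x * std_normal_density x" for x
  have gm [measurable]: "g \<in> borel_measurable borel"
    unfolding g_def [abs_def] by measurable
  have gint: "integrable lborel g"
    by (rule Bochner_Integration.integrable_bound[OF integrable_normal_density[of 1 0]])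
      (auto simp: g_def abs_mult intro!: mult_left_le_one_le k)
  have "(LINT t|std_normal_distribution. k t) = 0"
    unfolding k_def using hint prob_space by (simp add: c_def)
  then have g0: "(LINT t|lborel. g t) = 0"
    by (subst (asm) integral_density) (auto simp: g_def mult.commute)
  define G where "G x = (LINT t:{..x}|lborel. g t)" for x
  have si: "set_integrable lborel S g" if "S \<in> sets borel" for S
    using gint that unfolding set_integrable_def by (intro integrable_mult_indicator) auto
  have G_top: "(G \<longlongrightarrow> 0) at_top"
    using tendsto_integral_at_top[OF _ gint] g0 by (simp add: G_def [abs_def] set_lebesgue_integral_def)
  \<comment> \<open>Up to a constant, \<open>G\<close> becomes an integral over a compact interval,
    to which the fundamental theorem of calculus applies.\<close>
  have G_split: "G x = G a + integral {a..x} g" if "a \<le> x" for a x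
  proof -
    have "{..x} = {..a} \<union> {a<..x}"
      using that by auto
    then have "G x = G a + (LINT t:{a<..x}|lborel. g t)"
      unfolding G_def by (simp only:) (subst set_integral_Un, auto intro: si)
    also have "(LINT t:{a<..x}|lborel. g t) = (LINT t:{a..x}|lborel. g t)"
      unfolding set_lebesgue_integral_def
      by (intro integral_cong_AE) (auto intro!: AE_I[of _ _ "{a}"] simp: indicator_def)
    also have "\<dots> = integral {a..x} g"
      by (intro set_borel_integral_eq_integral si) auto
    finally show ?thesis .
  qed
  have g_cont: "continuous_on S g" for S
    unfolding g_def k_def std_normal_density_def
    by (intro continuous_intros continuous_on_subset[OF cont]) auto
  have dG: "(G has_real_derivative k x * std_normal_density x) (at x)" for x
  proof -
    have "((\<lambda>y. integral {x - 1..y} g) has_real_derivative g x) (at x within {x - 1..x + 1})"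
      by (rule integral_has_real_derivative) (auto intro: g_cont)
    then have "((\<lambda>y. integral {x - 1..y} g) has_real_derivative g x) (at x)"
      by (simp add: at_within_Icc_at)
    then have "((\<lambda>y. G (x - 1) + integral {x - 1..y} g) has_real_derivative g x) (at x)"
      by (auto intro!: derivative_eq_intros)
    moreover have "\<forall>\<^sub>F y in nhds x. G y = G (x - 1) + integral {x - 1..y} g"
      using eventually_nhds_in_open[of "{x - 1<..}" x]
      by (auto elim!: eventually_mono intro: G_split)
    ultimately show ?thesis
      by (subst DERIV_cong_ev[OF refl _ refl]) (auto simp: g_def)
  qed
  \<comment> \<open>Since |h - c| <= 1, the absolute value of \<open>G x\<close> is at most the
    normal mass below x.\<close>
  have G_bot: "((\<lambda>x. G (- x)) \<longlongrightarrow> 0) at_top"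
  proof (rule tendsto_sandwich[where f = "\<lambda>x. - cdf std_normal_distribution (- x)"
        and h = "\<lambda>x. cdf std_normal_distribution (- x)"])
    have *: "((\<lambda>x. cdf std_normal_distribution (- x)) \<longlongrightarrow> 0) at_top"
      using cdf_lim_at_bot by (rule filterlim_compose) (rule filterlim_uminus_at_bot_at_top)
    then show "((\<lambda>x. cdf std_normal_distribution (- x)) \<longlongrightarrow> 0) at_top" .
    show "((\<lambda>x. - cdf std_normal_distribution (- x)) \<longlongrightarrow> 0) at_top"
      using tendsto_minus[OF *] by simp
    have "\<bar>G x\<bar> \<le> cdf std_normal_distribution x" for x
    proof -
      have "\<bar>G x\<bar> \<le> (LINT t|lborel. \<bar>indicator {..x} t * g t\<bar>)"
        unfolding G_def set_lebesgue_integral_def by (simp add: integral_abs_bound)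
      also have "\<dots> \<le> (LINT t|lborel. std_normal_density t * indicator {..x} t)"
      proof (rule integral_mono)
        show "integrable lborel (\<lambda>t. \<bar>indicator {..x} t * g t\<bar>)"
          using si[of "{..x}"] by (intro integrable_abs) (simp add: set_integrable_def)
        show "integrable lborel (\<lambda>t. std_normal_density t * indicator {..x} t)"
          by (intro integrable_real_mult_indicator) auto
      qed (use k in \<open>auto simp: indicator_def g_def abs_mult intro!: mult_left_le_one_le\<close>)
      also have "\<dots> = (LINT t|std_normal_distribution. indicator {..x} t)"
        by (subst integral_density) auto
      also have "\<dots> = cdf std_normal_distribution x"
        by (simp add: cdf_def2)
      finally show ?thesis .
    qed
    then show "\<forall>\<^sub>F x in at_top. - cdf std_normal_distribution (- x) \<le> G (- x)"
      "\<forall>\<^sub>F x in at_top. G (- x) \<le> cdf std_normal_distribution (- x)"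
      by (auto simp: abs_le_iff minus_le_iff)
  qed
  define f where "f x = G x / std_normal_density x" for x
  have pos: "std_normal_density x > 0" for x
    by (rule normal_density_pos) simp
  have even: "std_normal_density (- x) = std_normal_density x" for x
    by (simp add: std_normal_density_def)
  have df: "(f has_real_derivative x * f x + k x) (at x)" for x
    unfolding f_def using pos[of x]
    by (auto intro!: derivative_eq_intros dG has_real_derivative_std_normal_density simp: field_simps)
  have xf: "\<bar>x * f x\<bar> \<le> 1" for x
  proof (cases x "0::real" rule: linorder_cases)
    case greater
    then show ?thesis
      using gaussian_tail_bound[OF dG k G_top greater] pos[of x]
      by (simp add: f_def abs_mult field_simps)
  next
    case less
    \<comment> \<open>The reflection y to G(-y) has the same form, with \<open>k\<close> replaced by
      y to -k(-y), and vanishes at infinity by \<open>G_bot\<close>; so the tail bound covers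
      negative x as well.\<close>
    have "((\<lambda>y. G (- y)) has_real_derivative (- k (- y)) * std_normal_density y) (at y)" for y
      using DERIV_mirror[where f = G and x = y] dG[of "- y"]
      by (simp add: even)
    then have "\<bar>G (- (- x))\<bar> \<le> std_normal_density (- x) / (- x)"
      using less k G_bot by (intro gaussian_tail_bound[where k = "\<lambda>y. - k (- y)"]) auto
    then show ?thesis
      using less pos[of x] by (simp add: f_def abs_mult even field_simps)
  qed simp
  have f': "\<bar>x * f x + k x\<bar> \<le> 2" for x
    using xf[of x] k[of x] by linarith
  have f_lip: "\<bar>f x - f y\<bar> \<le> 2 * \<bar>x - y\<bar>" for x y
    using field_differentiable_bound[of UNIV f "\<lambda>x. x * f x + k x" 2 x y] df f'
    by (auto)
  \<comment> \<open>For |x| >= 1 this follows from |x f(x)| <= 1. Otherwise x is compared with the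
    nearer of 1 and -1, where |f| <= 1; the Lipschitz constant 2 adds at most 2.\<close>
  have "\<bar>f x\<bar> \<le> 3" for x
  proof (cases "\<bar>x\<bar> \<ge> 1")
    case True
    have "\<bar>f x\<bar> \<le> \<bar>x\<bar> * \<bar>f x\<bar>"
      using True by (intro mult_le_cancel_right1[THEN iffD2]) auto
    then show ?thesis
      using xf[of x] by (simp add: abs_mult)
  next
    case False
    define s :: real where "s = (if x \<ge> 0 then 1 else -1)"
    have "\<bar>f s\<bar> \<le> 1" "\<bar>x - s\<bar> \<le> 1"
      using xf[of s] False by (auto simp: s_def)
    then show ?thesis
      using f_lip[of x s] by (smt (verit))
  qed
  then show thesis
    using that[of f] df f' by (auto simp: k_def)
qed

section \<open>Piecewise linear smoothing of half-line indicators\<close>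

definition ramp :: "real \<Rightarrow> real \<Rightarrow> real \<Rightarrow> real" where
  "ramp z \<epsilon> w = max 0 (min 1 ((z + \<epsilon> - w) / \<epsilon>))"

lemma ramp_bounds: "0 \<le> ramp z \<epsilon> w" "ramp z \<epsilon> w \<le> 1"
  by (auto simp: ramp_def)

lemma ramp_eq_1: "\<epsilon> > 0 \<Longrightarrow> w \<le> z \<Longrightarrow> ramp z \<epsilon> w = 1"
  by (simp add: ramp_def field_simps)

lemma ramp_eq_0: "\<epsilon> > 0 \<Longrightarrow> z + \<epsilon> \<le> w \<Longrightarrow> ramp z \<epsilon> w = 0"
  by (simp add: ramp_def field_simps)

lemma continuous_on_ramp: "continuous_on S (ramp z \<epsilon>)"
  unfolding ramp_def [abs_def] divide_inverse by (intro continuous_intros)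

lemma indicator_le_ramp: "\<epsilon> > 0 \<Longrightarrow> indicator {..z} w \<le> ramp z \<epsilon> w"
  by (auto simp: indicator_def ramp_eq_1 ramp_bounds)

lemma ramp_le_indicator: "\<epsilon> > 0 \<Longrightarrow> ramp z \<epsilon> w \<le> indicator {..z + \<epsilon>} w"
  by (auto simp: indicator_def ramp_eq_0 ramp_bounds)

text \<open>The ramp has slope -1/\<epsilon> on an interval of length \<epsilon> and is constant on
  either side. If w lies outside the widened interval, both points are on the same flat side. The
  indicator is taken at w because s will be an unknown point from the mean value theorem.\<close>

lemma abs_ramp_diff_le:
  assumes "\<epsilon> > 0" "\<bar>w - s\<bar> \<le> t"
  shows "\<bar>ramp z \<epsilon> w - ramp z \<epsilon> s\<bar> \<le> t / \<epsilon> * indicator {z - t..z + \<epsilon> + t} w"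
proof (cases "w \<in> {z - t..z + \<epsilon> + t}")
  case True
  have "\<bar>ramp z \<epsilon> w - ramp z \<epsilon> s\<bar> \<le> \<bar>(z + \<epsilon> - w) / \<epsilon> - (z + \<epsilon> - s) / \<epsilon>\<bar>"
    unfolding ramp_def by (auto simp: max_def min_def)
  also have "\<dots> = \<bar>w - s\<bar> / \<epsilon>"
    using assms by (simp add: diff_divide_distrib[symmetric] abs_minus_commute)
  also have "\<dots> \<le> t / \<epsilon>"
    using assms by (intro divide_right_mono) auto
  finally show ?thesis
    using True by simp
next
  case False
  then consider "w < z" "s < z" | "w > z + \<epsilon>" "s > z + \<epsilon>"
    using assms by fastforce
  then show ?thesis
    using False assms by cases (auto simp: ramp_eq_0 ramp_eq_1)
qed

text \<open>A form of the mean value theorem that allows either sign of t, since the local sums it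
  is applied to have no fixed sign.\<close>

lemma mean_value_between:
  fixes f :: "real \<Rightarrow> real"
  assumes "\<And>x. (f has_real_derivative f' x) (at x)"
  obtains s where "\<bar>w - s\<bar> \<le> \<bar>t\<bar>" "f w - f (w - t) = t * f' s"
proof (cases t "0::real" rule: linorder_cases)
  case equal
  then show thesis
    using that[of w] by simp
next
  case greater
  then obtain s where "w - t < s" "s < w" "f w - f (w - t) = (w - (w - t)) * f' s"
    using MVT2[of "w - t" w f f'] assms by auto
  then show thesis
    using that[of s] by simp
next
  case less
  then obtain s where "w < s" "s < w - t" "f (w - t) - f w = ((w - t) - w) * f' s"
    using MVT2[of w "w - t" f f'] assms by auto
  then show thesis
    using that[of s] by (simp add: algebra_simps)
qed

text \<open>The ramp has kinks, so f need not be twice differentiable. Instead the mean value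
  theorem turns the increment of f into t f'(s), and the Stein equation expresses f'(w) - f'(s) as
  (w - s) f(s) + w (f(w) - f(s)) plus a ramp difference. Each summand is at most a multiple of
  |t|.\<close>

lemma stein_remainder_le:
  fixes f :: "real \<Rightarrow> real"
  assumes deriv: "\<And>x. (f has_real_derivative x * f x + (ramp z \<epsilon> x - c)) (at x)"
    and f': "\<And>x. \<bar>x * f x + (ramp z \<epsilon> x - c)\<bar> \<le> 2"
    and f: "\<And>x. \<bar>f x\<bar> \<le> 3"
    and "\<epsilon> > 0"
  shows "\<bar>t * (w * f w + (ramp z \<epsilon> w - c)) - (f w - f (w - t))\<bar>
    \<le> t\<^sup>2 * (3 + 2 * \<bar>w\<bar> + indicator {z - \<bar>t\<bar>..z + \<epsilon> + \<bar>t\<bar>} w / \<epsilon>)"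
proof -
  obtain s where s: "\<bar>w - s\<bar> \<le> \<bar>t\<bar>" "f w - f (w - t) = t * (s * f s + (ramp z \<epsilon> s - c))"
    using mean_value_between[of f "\<lambda>x. x * f x + (ramp z \<epsilon> x - c)", OF deriv] .
  have lip: "\<bar>f w - f s\<bar> \<le> 2 * \<bar>t\<bar>"
  proof -
    obtain r where "f w - f (w - (w - s)) = (w - s) * (r * f r + (ramp z \<epsilon> r - c))"
      using mean_value_between[of f "\<lambda>x. x * f x + (ramp z \<epsilon> x - c)", OF deriv] .
    then have "\<bar>f w - f s\<bar> = \<bar>w - s\<bar> * \<bar>r * f r + (ramp z \<epsilon> r - c)\<bar>"
      by (simp add: abs_mult)
    also have "\<dots> \<le> \<bar>t\<bar> * 2"
      using s(1) f' by (intro mult_mono) auto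
    finally show ?thesis
      by simp
  qed
  let ?I = "indicator {z - \<bar>t\<bar>..z + \<epsilon> + \<bar>t\<bar>} w :: real"
  have "\<bar>(w * f w + (ramp z \<epsilon> w - c)) - (s * f s + (ramp z \<epsilon> s - c))\<bar>
      = \<bar>(w - s) * f s + w * (f w - f s) + (ramp z \<epsilon> w - ramp z \<epsilon> s)\<bar>"
    by (simp add: algebra_simps)
  also have "\<dots> \<le> \<bar>w - s\<bar> * \<bar>f s\<bar> + \<bar>w\<bar> * \<bar>f w - f s\<bar> + \<bar>ramp z \<epsilon> w - ramp z \<epsilon> s\<bar>"
    unfolding abs_mult[symmetric] by linarith
  also have "\<dots> \<le> \<bar>t\<bar> * 3 + \<bar>w\<bar> * (2 * \<bar>t\<bar>) + \<bar>t\<bar> / \<epsilon> * ?I"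
    using s(1) f lip assms(4) by (intro add_mono mult_mono abs_ramp_diff_le) auto
  also have "\<dots> = \<bar>t\<bar> * (3 + 2 * \<bar>w\<bar> + ?I / \<epsilon>)"
    by (simp add: algebra_simps)
  finally have "\<bar>t\<bar> * \<bar>(w * f w + (ramp z \<epsilon> w - c)) - (s * f s + (ramp z \<epsilon> s - c))\<bar>
      \<le> \<bar>t\<bar> * (\<bar>t\<bar> * (3 + 2 * \<bar>w\<bar> + ?I / \<epsilon>))"
    by (intro mult_left_mono) auto
  moreover have "\<bar>t\<bar> * (\<bar>t\<bar> * (3 + 2 * \<bar>w\<bar> + ?I / \<epsilon>)) = t\<^sup>2 * (3 + 2 * \<bar>w\<bar> + ?I / \<epsilon>)"
    by (simp add: power2_eq_square mult.assoc[symmetric])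
  ultimately show ?thesis
    unfolding s(2) by (simp only: right_diff_distrib[symmetric] abs_mult)
qed

section \<open>Normal approximation of sums of m-dependent variables\<close>

text \<open>Independence of the past and the future across a gap of d indices is an equality of
  pmfs, so that it passes through \<open>map_pmf\<close>. Coordinates outside a block are set to 0,
  which makes every block a function on all of \<open>nat\<close>.\<close>

definition m_dependent :: "nat \<Rightarrow> 'a pmf \<Rightarrow> (nat \<Rightarrow> 'a \<Rightarrow> real) \<Rightarrow> bool" where
  "m_dependent d M X \<longleftrightarrow> (\<forall>a.
     map_pmf (\<lambda>\<omega>. (\<lambda>j. if j + d < a then X j \<omega> else 0, \<lambda>j. if j < a then 0 else X j \<omega>)) M
     = pair_pmf (map_pmf (\<lambda>\<omega> j. if j + d < a then X j \<omega> else 0) M)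
                (map_pmf (\<lambda>\<omega> j. if j < a then 0 else X j \<omega>) M))"

lemma indep_map_pmf:
  assumes "map_pmf (\<lambda>\<omega>. (U \<omega>, V \<omega>)) M = pair_pmf (map_pmf U M) (map_pmf V M)"
  shows "map_pmf (\<lambda>\<omega>. (f (U \<omega>), g (V \<omega>))) M
    = pair_pmf (map_pmf (\<lambda>\<omega>. f (U \<omega>)) M) (map_pmf (\<lambda>\<omega>. g (V \<omega>)) M)"
  using arg_cong[OF assms, of "map_pmf (\<lambda>(x, y). (f x, g y))"]
  by (simp add: map_pair map_pmf_comp)

lemma expectation_pair_pmf_finite:
  fixes f :: "'a \<times> 'b \<Rightarrow> real"
  assumes "finite (set_pmf P)" "finite (set_pmf Q)"
  shows "measure_pmf.expectation (pair_pmf P Q) f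
    = measure_pmf.expectation P (\<lambda>x. measure_pmf.expectation Q (\<lambda>y. f (x, y)))"
proof -
  have "measure_pmf.expectation (pair_pmf P Q) f
      = (\<Sum>p\<in>set_pmf P \<times> set_pmf Q. f p * pmf (pair_pmf P Q) p)"
    using assms by (intro integral_measure_pmf_real) auto
  also have "\<dots> = (\<Sum>x\<in>set_pmf P. \<Sum>y\<in>set_pmf Q. f (x, y) * (pmf P x * pmf Q y))"
    unfolding sum.cartesian_product by (intro sum.cong refl) (auto simp: pmf_pair)
  also have "\<dots> = (\<Sum>x\<in>set_pmf P. (\<Sum>y\<in>set_pmf Q. f (x, y) * pmf Q y) * pmf P x)"
    by (simp add: sum_distrib_left mult_ac)
  also have "\<dots> = (\<Sum>x\<in>set_pmf P. measure_pmf.expectation Q (\<lambda>y. f (x, y)) * pmf P x)"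
    using assms by (intro sum.cong refl arg_cong2[of _ _ _ _ "(*)"] integral_measure_pmf_real[symmetric]) auto
  also have "\<dots> = measure_pmf.expectation P (\<lambda>x. measure_pmf.expectation Q (\<lambda>y. f (x, y)))"
    using assms by (intro integral_measure_pmf_real[symmetric]) auto
  finally show ?thesis .
qed

locale m_dependent_sum =
  fixes M :: "'a pmf" and X :: "nat \<Rightarrow> 'a \<Rightarrow> real" and N d :: nat and A :: real
  assumes finite_support: "finite (set_pmf M)"
    and dependence: "m_dependent d M X"
    and mean_zero: "\<And>i. i < N \<Longrightarrow> measure_pmf.expectation M (X i) = 0"
    and bounded: "\<And>i \<omega>. i < N \<Longrightarrow> \<bar>X i \<omega>\<bar> \<le> A"
    and unit_variance: "measure_pmf.expectation M (\<lambda>\<omega>. (\<Sum>i<N. X i \<omega>)\<^sup>2) = 1"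
begin

abbreviation E :: "('a \<Rightarrow> real) \<Rightarrow> real" where
  "E \<equiv> measure_pmf.expectation M"

lemma int [simp, intro]: "integrable (measure_pmf M) (f :: 'a \<Rightarrow> real)"
  using finite_support by (rule integrable_measure_pmf_finite)

lemma E_mono: "(\<And>\<omega>. f \<omega> \<le> g \<omega>) \<Longrightarrow> E f \<le> E g"
  by (intro integral_mono) auto

lemma E_nonneg: "(\<And>\<omega>. 0 \<le> f \<omega>) \<Longrightarrow> 0 \<le> E f"
  by (intro Bochner_Integration.integral_nonneg) auto

lemma E_sum: "E (\<lambda>\<omega>. \<Sum>i\<in>I. f i \<omega>) = (\<Sum>i\<in>I. E (f i))"
  by (intro Bochner_Integration.integral_sum) auto

lemma E_abs_le: "\<bar>E f\<bar> \<le> E (\<lambda>\<omega>. \<bar>f \<omega>\<bar>)"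
  by (rule integral_abs_bound)

text \<open>Dependence is assumed only across one cut, whereas \<open>G\<close> may look at both
  sides of the block [a, b). Cutting at a separates \<open>L\<close> from the pair of
  \<open>C\<close> and \<open>R\<close>, and cutting at b + d separates \<open>C\<close> from
  \<open>R\<close>; together the three are independent. \<open>L\<close> and \<open>R\<close> live
  on disjoint index sets, so their sum carries all that \<open>G\<close> sees.\<close>

lemma expectation_mult_indep:
  fixes F G :: "(nat \<Rightarrow> real) \<Rightarrow> real"
  assumes "a \<le> b"
    and F: "\<And>x y. (\<And>j. a \<le> j \<Longrightarrow> j < b \<Longrightarrow> x j = y j) \<Longrightarrow> F x = F y"
    and G: "\<And>x y. (\<And>j. j + d < a \<or> b + d \<le> j \<Longrightarrow> x j = y j) \<Longrightarrow> G x = G y"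
  shows "E (\<lambda>\<omega>. F (\<lambda>j. X j \<omega>) * G (\<lambda>j. X j \<omega>)) = E (\<lambda>\<omega>. F (\<lambda>j. X j \<omega>)) * E (\<lambda>\<omega>. G (\<lambda>j. X j \<omega>))"
proof -
  define L where "L \<omega> = (\<lambda>j. if j + d < a then X j \<omega> else 0)" for \<omega>
  define C where "C \<omega> = (\<lambda>j. if a \<le> j \<and> j < b then X j \<omega> else 0)" for \<omega>
  define R where "R \<omega> = (\<lambda>j. if j < b + d then 0 else X j \<omega>)" for \<omega>
  define U where "U \<omega> = (\<lambda>j. if j < a then 0 else X j \<omega>)" for \<omega>
  define V where "V \<omega> = (\<lambda>j. if j + d < b + d then X j \<omega> else 0)" for \<omega>
  have LU: "map_pmf (\<lambda>\<omega>. (L \<omega>, U \<omega>)) M = pair_pmf (map_pmf L M) (map_pmf U M)"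
    using dependence unfolding m_dependent_def L_def [abs_def] U_def [abs_def] by blast
  have VR: "map_pmf (\<lambda>\<omega>. (V \<omega>, R \<omega>)) M = pair_pmf (map_pmf V M) (map_pmf R M)"
    using dependence unfolding m_dependent_def V_def [abs_def] R_def [abs_def] by blast
  have C_V: "C \<omega> = (\<lambda>j. if a \<le> j then V \<omega> j else 0)" for \<omega>
    by (auto simp: C_def V_def)
  have C_U: "C \<omega> = (\<lambda>j. if j < b then U \<omega> j else 0)" for \<omega>
    by (auto simp: C_def U_def)
  have R_U: "R \<omega> = (\<lambda>j. if j < b + d then 0 else U \<omega> j)" for \<omega>
    using \<open>a \<le> b\<close> by (auto simp: R_def U_def)
  have CR: "map_pmf (\<lambda>\<omega>. (C \<omega>, R \<omega>)) M = pair_pmf (map_pmf C M) (map_pmf R M)"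
    using indep_map_pmf[OF VR, of "\<lambda>v j. if a \<le> j then v j else 0" "\<lambda>r. r"]
    unfolding C_V[abs_def] by simp
  have "map_pmf (\<lambda>\<omega>. (L \<omega>, C \<omega>, R \<omega>)) M
      = pair_pmf (map_pmf L M) (map_pmf (\<lambda>\<omega>. (C \<omega>, R \<omega>)) M)"
    using indep_map_pmf[OF LU, of "\<lambda>l. l"
        "\<lambda>u. ((\<lambda>j. if j < b then u j else 0), (\<lambda>j. if j < b + d then 0 else u j))"]
    unfolding C_U[abs_def] R_U[abs_def] by simp
  then have LCR: "map_pmf (\<lambda>\<omega>. (L \<omega>, C \<omega>, R \<omega>)) M
      = pair_pmf (map_pmf L M) (pair_pmf (map_pmf C M) (map_pmf R M))"
    by (simp add: CR)
  have E3: "E (\<lambda>\<omega>. K (L \<omega>) (C \<omega>) (R \<omega>)) = measure_pmf.expectation (map_pmf L M) (\<lambda>l.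
      measure_pmf.expectation (map_pmf C M) (\<lambda>c. measure_pmf.expectation (map_pmf R M) (\<lambda>r. K l c r)))"
    for K :: "_ \<Rightarrow> _ \<Rightarrow> _ \<Rightarrow> real"
  proof -
    have "E (\<lambda>\<omega>. K (L \<omega>) (C \<omega>) (R \<omega>))
        = measure_pmf.expectation (map_pmf (\<lambda>\<omega>. (L \<omega>, C \<omega>, R \<omega>)) M) (\<lambda>(l, c, r). K l c r)"
      by simp
    also have "\<dots> = measure_pmf.expectation (map_pmf L M) (\<lambda>l.
      measure_pmf.expectation (map_pmf C M) (\<lambda>c. measure_pmf.expectation (map_pmf R M) (\<lambda>r. K l c r)))"
      unfolding LCR using finite_support
      by (subst expectation_pair_pmf_finite, simp, simp)+ simp
    finally show ?thesis .
  qed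
  have F': "F (\<lambda>j. X j \<omega>) = F (C \<omega>)" for \<omega>
    by (rule F) (simp add: C_def)
  have G': "G (\<lambda>j. X j \<omega>) = G (\<lambda>j. L \<omega> j + R \<omega> j)" for \<omega>
    using \<open>a \<le> b\<close> by (intro G) (auto simp: L_def R_def)
  let ?EL = "measure_pmf.expectation (map_pmf L M)"
    and ?EC = "measure_pmf.expectation (map_pmf C M)"
    and ?ER = "measure_pmf.expectation (map_pmf R M)"
  have "E (\<lambda>\<omega>. F (C \<omega>) * G (\<lambda>j. L \<omega> j + R \<omega> j))
      = ?EL (\<lambda>l. ?EC (\<lambda>c. ?ER (\<lambda>r. F c * G (\<lambda>j. l j + r j))))"
    by (rule E3)
  also have "\<dots> = ?EC F * ?EL (\<lambda>l. ?ER (\<lambda>r. G (\<lambda>j. l j + r j)))"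
    by (simp only: integral_mult_left_zero integral_mult_right_zero)
  also have "?EC F = E (\<lambda>\<omega>. F (C \<omega>))"
    by simp
  \<comment> \<open>A vacuous integration over \<open>C\<close> is inserted so that
    \<open>E3\<close> can be read backwards.\<close>
  also have "?EL (\<lambda>l. ?ER (\<lambda>r. G (\<lambda>j. l j + r j))) = ?EL (\<lambda>l. ?EC (\<lambda>c. ?ER (\<lambda>r. G (\<lambda>j. l j + r j))))"
    by simp
  also have "\<dots> = E (\<lambda>\<omega>. G (\<lambda>j. L \<omega> j + R \<omega> j))"
    by (rule E3[symmetric])
  finally have "E (\<lambda>\<omega>. F (C \<omega>) * G (\<lambda>j. L \<omega> j + R \<omega> j))
      = E (\<lambda>\<omega>. F (C \<omega>)) * E (\<lambda>\<omega>. G (\<lambda>j. L \<omega> j + R \<omega> j))" .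
  then show ?thesis
    by (simp add: F' G')
qed

section \<open>Second moments of sums over index neighbourhoods\<close>

definition nb :: "nat \<Rightarrow> nat \<Rightarrow> nat set" where
  "nb r i = {j. j < N \<and> j \<le> i + r \<and> i \<le> j + r}"

lemma finite_nb [simp]: "finite (nb r i)"
  by (rule finite_subset[of _ "{..<N}"]) (auto simp: nb_def)

lemma nb_subset: "nb r i \<subseteq> {..<N}"
  by (auto simp: nb_def)

lemma card_nb: "real (card (nb r i)) \<le> 2 * real r + 1"
proof -
  have "card (nb r i) \<le> card {i - r..i + r}"
    by (intro card_mono) (auto simp: nb_def)
  also have "\<dots> \<le> 2 * r + 1"
    by simp
  finally show ?thesis
    by linarith
qed

text \<open>Being within distance r is a symmetric relation, so after exchanging the sums each
  \<open>g j\<close> is counted at most 2r + 1 times.\<close>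

lemma sum_sum_nb_le:
  fixes g :: "nat \<Rightarrow> real"
  assumes "\<And>j. j < N \<Longrightarrow> 0 \<le> g j"
  shows "(\<Sum>i<N. \<Sum>j\<in>nb r i. g j) \<le> (2 * real r + 1) * (\<Sum>j<N. g j)"
proof -
  have "(\<Sum>i<N. \<Sum>j\<in>nb r i. g j) = (\<Sum>i<N. \<Sum>j<N. if j \<in> nb r i then g j else 0)"
    by (intro sum.cong refl sum.mono_neutral_cong_left) (auto simp: nb_def)
  also have "\<dots> = (\<Sum>j<N. \<Sum>i<N. if j \<in> nb r i then g j else 0)"
    by (rule sum.swap)
  also have "\<dots> = (\<Sum>j<N. \<Sum>i\<in>nb r j. g j)"
    by (intro sum.cong refl sum.mono_neutral_cong_right) (auto simp: nb_def)
  also have "\<dots> = (\<Sum>j<N. real (card (nb r j)) * g j)"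
    by simp
  also have "\<dots> \<le> (\<Sum>j<N. (2 * real r + 1) * g j)"
    by (intro sum_mono mult_right_mono card_nb assms) auto
  finally show ?thesis
    by (simp add: sum_distrib_left)
qed

text \<open>Only pairs within distance r survive the expansion of the square. Each mixed moment is
  at most half the sum of the two second moments, and each index meets at most 2r + 1 others, itself
  included.\<close>

lemma E_sum_squared_le:
  assumes orth: "\<And>i j. i < N \<Longrightarrow> j < N \<Longrightarrow> j \<notin> nb r i \<Longrightarrow> E (\<lambda>\<omega>. Z i \<omega> * Z j \<omega>) = 0"
  shows "E (\<lambda>\<omega>. (\<Sum>i<N. Z i \<omega>)\<^sup>2) \<le> (2 * real r + 1) * (\<Sum>i<N. E (\<lambda>\<omega>. (Z i \<omega>)\<^sup>2))"
proof -
  let ?v = "\<lambda>i. E (\<lambda>\<omega>. (Z i \<omega>)\<^sup>2)"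
  have v: "0 \<le> ?v i" for i
    by (rule E_nonneg) simp
  have "E (\<lambda>\<omega>. (\<Sum>i<N. Z i \<omega>)\<^sup>2) = (\<Sum>i<N. \<Sum>j<N. E (\<lambda>\<omega>. Z i \<omega> * Z j \<omega>))"
    by (simp add: power2_eq_square sum_product E_sum)
  also have "\<dots> = (\<Sum>i<N. \<Sum>j\<in>nb r i. E (\<lambda>\<omega>. Z i \<omega> * Z j \<omega>))"
    by (intro sum.cong refl sum.mono_neutral_right) (auto simp: orth nb_subset nb_def)
  also have "\<dots> \<le> (\<Sum>i<N. \<Sum>j\<in>nb r i. ?v i / 2 + ?v j / 2)"
  proof (intro sum_mono)
    fix i j
    have "E (\<lambda>\<omega>. Z i \<omega> * Z j \<omega>) \<le> E (\<lambda>\<omega>. (Z i \<omega>)\<^sup>2 / 2 + (Z j \<omega>)\<^sup>2 / 2)"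
    proof (rule E_mono)
      fix \<omega>
      show "Z i \<omega> * Z j \<omega> \<le> (Z i \<omega>)\<^sup>2 / 2 + (Z j \<omega>)\<^sup>2 / 2"
        using sum_squares_bound[of "Z i \<omega>" "Z j \<omega>"] by simp
    qed
    then show "E (\<lambda>\<omega>. Z i \<omega> * Z j \<omega>) \<le> ?v i / 2 + ?v j / 2"
      by simp
  qed
  also have "\<dots> = (\<Sum>i<N. real (card (nb r i)) * (?v i / 2)) + (\<Sum>i<N. \<Sum>j\<in>nb r i. ?v j / 2)"
    by (simp add: sum.distrib)
  also have "\<dots> \<le> (\<Sum>i<N. (2 * real r + 1) * (?v i / 2)) + (2 * real r + 1) * (\<Sum>i<N. ?v i / 2)"
    by (intro add_mono sum_mono mult_right_mono card_nb sum_sum_nb_le) (use v in auto)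
  also have "\<dots> = (2 * real r + 1) * (\<Sum>i<N. ?v i)"
    by (simp add: sum_distrib_left[symmetric] sum_divide_distrib[symmetric])
  finally show ?thesis .
qed

section \<open>Local sums and the error scale\<close>

definition W :: "'a \<Rightarrow> real" where
  "W \<omega> = (\<Sum>i<N. X i \<omega>)"

definition V :: real where
  "V = (\<Sum>i<N. E (\<lambda>\<omega>. (X i \<omega>)\<^sup>2))"

definition \<eta> :: "nat \<Rightarrow> nat \<Rightarrow> 'a \<Rightarrow> real" where
  "\<eta> r i \<omega> = (\<Sum>j\<in>nb r i. X j \<omega>)"

text \<open>A single scale for all error terms: it bounds the local sums \<open>\<eta> d i\<close>,
  and up to constants the fluctuation of the quadratic form and the cubic remainder.
  \<open>V * A\<close> stands in for the sum of the third absolute moments, which it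
  dominates.\<close>

definition B :: real where
  "B = (2 * real d + 1)\<^sup>2 * V * A"

lemma E_W_sq: "E (\<lambda>\<omega>. (W \<omega>)\<^sup>2) = 1"
  using unit_variance by (simp add: W_def)

lemma W_minus_\<eta>: "W \<omega> - \<eta> r i \<omega> = (\<Sum>j\<in>{..<N} - nb r i. X j \<omega>)"
  unfolding W_def \<eta>_def using nb_subset by (simp add: sum_diff)

text \<open>Removing the indices within distance d of i from \<open>W\<close> leaves a sum
  independent of \<open>X i\<close>, which has mean zero.\<close>

lemma E_X_mult_far:
  assumes "i < N"
  shows "E (\<lambda>\<omega>. X i \<omega> * g (W \<omega> - \<eta> d i \<omega>)) = 0"
proof -
  have "E (\<lambda>\<omega>. (\<lambda>x. x i) (\<lambda>j. X j \<omega>) * (\<lambda>x. g (\<Sum>j\<in>{..<N} - nb d i. x j)) (\<lambda>j. X j \<omega>))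
      = E (\<lambda>\<omega>. (\<lambda>x. x i) (\<lambda>j. X j \<omega>)) * E (\<lambda>\<omega>. (\<lambda>x. g (\<Sum>j\<in>{..<N} - nb d i. x j)) (\<lambda>j. X j \<omega>))"
  proof (rule expectation_mult_indep[of i "Suc i"])
    fix x y :: "nat \<Rightarrow> real"
    assume eq: "\<And>j. j + d < i \<or> Suc i + d \<le> j \<Longrightarrow> x j = y j"
    show "g (\<Sum>j\<in>{..<N} - nb d i. x j) = g (\<Sum>j\<in>{..<N} - nb d i. y j)"
      by (intro arg_cong[of _ _ g] sum.cong refl eq) (auto simp: nb_def)
  qed auto
  then show ?thesis
    using mean_zero[OF assms] by (simp add: W_minus_\<eta>)
qed

text \<open>\<open>W\<close> has variance 1, and the variance of a d-dependent sum is at most 2d + 1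
  times \<open>V\<close>. The inequality lets later bounds be multiplied by (2d + 1)
  \<open>V\<close> to reach the form of \<open>B\<close>.\<close>

lemma V_lower: "1 \<le> (2 * real d + 1) * V"
proof -
  have "E (\<lambda>\<omega>. X i \<omega> * X j \<omega>) = 0" if ij: "i < N" "j < N" "j \<notin> nb d i" for i j
  proof -
    have "E (\<lambda>\<omega>. (\<lambda>x. x i) (\<lambda>j. X j \<omega>) * (\<lambda>x. x j) (\<lambda>j. X j \<omega>))
        = E (\<lambda>\<omega>. (\<lambda>x. x i) (\<lambda>j. X j \<omega>)) * E (\<lambda>\<omega>. (\<lambda>x. x j) (\<lambda>j. X j \<omega>))"
      using ij by (intro expectation_mult_indep[of i "Suc i"]) (auto simp: nb_def)
    then show ?thesis
      using mean_zero[OF ij(1)] by simp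
  qed
  then have "E (\<lambda>\<omega>. (\<Sum>i<N. X i \<omega>)\<^sup>2) \<le> (2 * real d + 1) * (\<Sum>i<N. E (\<lambda>\<omega>. (X i \<omega>)\<^sup>2))"
    by (rule E_sum_squared_le)
  then show ?thesis
    using unit_variance by (simp add: V_def)
qed

lemma V_pos: "V > 0"
  using V_lower by (smt (verit) mult_nonneg_nonpos of_nat_0_le_iff)

lemma A_pos: "A > 0"
proof (rule ccontr)
  assume "\<not> A > 0"
  then have "X i \<omega> = 0" if "i < N" for i \<omega>
    using bounded[OF that, of \<omega>] by simp
  then have "V = 0"
    by (simp add: V_def)
  then show False
    using V_pos by simp
qed

lemma B_pos: "B > 0"
  using V_pos A_pos by (simp add: B_def)

lemma DA_le_B: "(2 * real d + 1) * A \<le> B"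
proof -
  have "((2 * real d + 1) * A) * 1 \<le> ((2 * real d + 1) * A) * ((2 * real d + 1) * V)"
    using V_lower A_pos by (intro mult_left_mono) auto
  then show ?thesis
    by (simp add: B_def power2_eq_square mult_ac)
qed

lemma abs_\<eta>_le: "\<bar>\<eta> r i \<omega>\<bar> \<le> (2 * real r + 1) * A"
proof -
  have "\<bar>\<eta> r i \<omega>\<bar> \<le> (\<Sum>j\<in>nb r i. \<bar>X j \<omega>\<bar>)"
    unfolding \<eta>_def by (rule sum_abs)
  also have "\<dots> \<le> (\<Sum>j\<in>nb r i. A)"
    by (intro sum_mono bounded) (auto simp: nb_def)
  also have "\<dots> \<le> (2 * real r + 1) * A"
    using card_nb[of r i] A_pos by simp
  finally show ?thesis .
qed

lemma abs_\<eta>_le_B: "\<bar>\<eta> d i \<omega>\<bar> \<le> B" "\<bar>\<eta> (2 * d) i \<omega>\<bar> \<le> 2 * B"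
proof -
  show "\<bar>\<eta> d i \<omega>\<bar> \<le> B"
    using abs_\<eta>_le[of d i \<omega>] DA_le_B by (rule order_trans)
  have "\<bar>\<eta> (2 * d) i \<omega>\<bar> \<le> (2 * real (2 * d) + 1) * A"
    by (rule abs_\<eta>_le)
  also have "\<dots> \<le> 2 * ((2 * real d + 1) * A)"
    using A_pos by (simp add: algebra_simps)
  finally show "\<bar>\<eta> (2 * d) i \<omega>\<bar> \<le> 2 * B"
    using DA_le_B by linarith
qed

text \<open>\<open>X i\<close> is uncorrelated with \<open>W - \<eta> d i\<close>, so the local sum
  may be replaced by \<open>W\<close>; summing over i then gives the second moment of
  \<open>W\<close>.\<close>

lemma sum_E_X\<eta>: "(\<Sum>i<N. E (\<lambda>\<omega>. X i \<omega> * \<eta> d i \<omega>)) = 1"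
proof -
  have "E (\<lambda>\<omega>. X i \<omega> * \<eta> d i \<omega>) = E (\<lambda>\<omega>. X i \<omega> * W \<omega>)" if "i < N" for i
    using E_X_mult_far[OF that, of "\<lambda>x. x"] by (simp add: right_diff_distrib)
  then have "(\<Sum>i<N. E (\<lambda>\<omega>. X i \<omega> * \<eta> d i \<omega>)) = (\<Sum>i<N. E (\<lambda>\<omega>. X i \<omega> * W \<omega>))"
    by simp
  also have "\<dots> = E (\<lambda>\<omega>. \<Sum>i<N. X i \<omega> * W \<omega>)"
    by (rule E_sum[symmetric])
  also have "\<dots> = E (\<lambda>\<omega>. (W \<omega>)\<^sup>2)"
    by (simp only: W_def power2_eq_square sum_distrib_right)
  finally show ?thesis
    by (simp add: E_W_sq)
qed

text \<open>The products \<open>X i * \<eta> d i\<close> have means summing to 1, so this is an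
  absolute deviation and is bounded through the variance. Products whose indices differ by more than
  3d are uncorrelated, since each involves only indices within d of its own.\<close>

lemma E_abs_quadratic_deviation:
  "E (\<lambda>\<omega>. \<bar>1 - (\<Sum>i<N. X i \<omega> * \<eta> d i \<omega>)\<bar>) \<le> 2 * B"
proof -
  define Y where "Y i \<omega> = X i \<omega> * \<eta> d i \<omega>" for i \<omega>
  define Z where "Z i \<omega> = Y i \<omega> - E (Y i)" for i \<omega>
  have orth: "E (\<lambda>\<omega>. Z i \<omega> * Z k \<omega>) = 0" if ik: "i < N" "k < N" "k \<notin> nb (3 * d) i" for i k
  proof -
    define F where "F i x = x i * (\<Sum>j\<in>nb d i. x j) - E (Y i)" for i and x :: "nat \<Rightarrow> real"
    have F: "Z i \<omega> = F i (\<lambda>j. X j \<omega>)" for i \<omega>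
      by (simp add: F_def Z_def Y_def \<eta>_def)
    have F_cong: "F i x = F i y" if "i < N" "\<And>j. j \<in> nb d i \<Longrightarrow> x j = y j" for i x y
      using that by (auto simp: F_def nb_def intro!: arg_cong2[of _ _ _ _ "(*)"] sum.cong)
    have "E (\<lambda>\<omega>. F i (\<lambda>j. X j \<omega>) * F k (\<lambda>j. X j \<omega>))
        = E (\<lambda>\<omega>. F i (\<lambda>j. X j \<omega>)) * E (\<lambda>\<omega>. F k (\<lambda>j. X j \<omega>))"
    \<comment> \<open>The truncated \<open>i - d\<close> is harmless: if it is 0 by truncation, no
      index lies to the left of the block.\<close>
    proof (rule expectation_mult_indep[of "i - d" "i + d + 1"])
      fix x y :: "nat \<Rightarrow> real"
      assume eq: "\<And>j. i - d \<le> j \<Longrightarrow> j < i + d + 1 \<Longrightarrow> x j = y j"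
      show "F i x = F i y"
        using ik(1) by (rule F_cong) (rule eq; auto simp: nb_def)
    next
      fix x y :: "nat \<Rightarrow> real"
      assume eq: "\<And>j. j + d < i - d \<or> i + d + 1 + d \<le> j \<Longrightarrow> x j = y j"
      show "F k x = F k y"
        using ik(2) by (rule F_cong) (rule eq, use ik in \<open>auto simp: nb_def\<close>)
    qed simp
    moreover have "E (Z i) = 0"
      by (simp add: Z_def [abs_def])
    ultimately show ?thesis
      by (simp add: F [abs_def])
  qed
  have vZ: "E (\<lambda>\<omega>. (Z i \<omega>)\<^sup>2) \<le> ((2 * real d + 1) * A)\<^sup>2 * E (\<lambda>\<omega>. (X i \<omega>)\<^sup>2)" if "i < N" for i
  proof -
    have "E (\<lambda>\<omega>. (Z i \<omega>)\<^sup>2) = E (\<lambda>\<omega>. (Y i \<omega>)\<^sup>2) - (E (Y i))\<^sup>2"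
      by (simp add: Z_def measure_pmf.variance_eq)
    also have "\<dots> \<le> E (\<lambda>\<omega>. (Y i \<omega>)\<^sup>2)"
      by simp
    also have "\<dots> \<le> E (\<lambda>\<omega>. ((2 * real d + 1) * A)\<^sup>2 * (X i \<omega>)\<^sup>2)"
    proof (rule E_mono)
      fix \<omega>
      have "(\<eta> d i \<omega>)\<^sup>2 \<le> ((2 * real d + 1) * A)\<^sup>2"
        using power_mono[OF abs_\<eta>_le[of d i \<omega>], of 2] by simp
      then show "(Y i \<omega>)\<^sup>2 \<le> ((2 * real d + 1) * A)\<^sup>2 * (X i \<omega>)\<^sup>2"
        by (simp add: Y_def power_mult_distrib mult.commute mult_left_mono)
    qed
    finally show ?thesis
      by simp
  qed
  let ?S = "\<lambda>\<omega>. 1 - (\<Sum>i<N. X i \<omega> * \<eta> d i \<omega>)"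
  have S: "?S \<omega> = - (\<Sum>i<N. Z i \<omega>)" for \<omega>
    using sum_E_X\<eta> by (simp add: Z_def Y_def [abs_def] sum_subtractf)
  have "E (\<lambda>\<omega>. (?S \<omega>)\<^sup>2) \<le> (2 * real (3 * d) + 1) * (\<Sum>i<N. E (\<lambda>\<omega>. (Z i \<omega>)\<^sup>2))"
    unfolding S power2_minus using orth by (rule E_sum_squared_le)
  also have "\<dots> \<le> (2 * real (3 * d) + 1) * (\<Sum>i<N. ((2 * real d + 1) * A)\<^sup>2 * E (\<lambda>\<omega>. (X i \<omega>)\<^sup>2))"
    using vZ by (intro mult_left_mono sum_mono) auto
  also have "\<dots> = (6 * real d + 1) * (((2 * real d + 1) * A)\<^sup>2 * V)"
    by (simp add: V_def sum_distrib_left)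
  also have "\<dots> \<le> (3 * (2 * real d + 1)) * (((2 * real d + 1) * A)\<^sup>2 * V)"
    using V_pos by (intro mult_right_mono) auto
  also have "\<dots> = 3 * (((2 * real d + 1) * A)\<^sup>2 * ((2 * real d + 1) * V)) * 1"
    by simp
  \<comment> \<open>One more factor (2d + 1) \<open>V\<close>, which is at least 1, completes the
    square of \<open>B\<close>.\<close>
  also have "\<dots> \<le> 3 * (((2 * real d + 1) * A)\<^sup>2 * ((2 * real d + 1) * V)) * ((2 * real d + 1) * V)"
    using V_pos V_lower by (intro mult_left_mono) auto
  also have "\<dots> = 3 * B\<^sup>2"
    by (simp add: B_def power2_eq_square)
  finally have S2: "E (\<lambda>\<omega>. (?S \<omega>)\<^sup>2) \<le> 3 * B\<^sup>2" .
  \<comment> \<open>The inequality |s| <= s^2 / (2B) + B / 2 takes the place of a square root and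
    gives 3B/2 + B/2.\<close>
  have "E (\<lambda>\<omega>. \<bar>?S \<omega>\<bar>) \<le> E (\<lambda>\<omega>. (?S \<omega>)\<^sup>2 / (2 * B) + B / 2)"
  proof (rule E_mono)
    fix \<omega>
    show "\<bar>?S \<omega>\<bar> \<le> (?S \<omega>)\<^sup>2 / (2 * B) + B / 2"
      using sum_squares_bound[of "\<bar>?S \<omega>\<bar>" B] B_pos by (simp add: field_simps power2_eq_square)
  qed
  also have "\<dots> = E (\<lambda>\<omega>. (?S \<omega>)\<^sup>2) / (2 * B) + B / 2"
    by simp
  also have "\<dots> \<le> 3 * B\<^sup>2 / (2 * B) + B / 2"
    using S2 B_pos by (intro add_mono divide_right_mono) auto
  also have "\<dots> = 2 * B"
    using B_pos by (simp add: power2_eq_square)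
  finally show ?thesis .
qed

text \<open>One factor is bounded by \<open>A\<close>; Cauchy-Schwarz on the at most 2d + 1 terms of
  the local sum gives one factor 2d + 1, and double counting over i gives the other.\<close>

lemma sum_E_abs_X\<eta>_sq: "(\<Sum>i<N. E (\<lambda>\<omega>. \<bar>X i \<omega>\<bar> * (\<eta> d i \<omega>)\<^sup>2)) \<le> B"
proof -
  let ?D = "2 * real d + 1"
  have "E (\<lambda>\<omega>. \<bar>X i \<omega>\<bar> * (\<eta> d i \<omega>)\<^sup>2) \<le> A * ?D * (\<Sum>j\<in>nb d i. E (\<lambda>\<omega>. (X j \<omega>)\<^sup>2))" if "i < N" for i
  proof -
    have "E (\<lambda>\<omega>. \<bar>X i \<omega>\<bar> * (\<eta> d i \<omega>)\<^sup>2) \<le> E (\<lambda>\<omega>. A * (?D * (\<Sum>j\<in>nb d i. (X j \<omega>)\<^sup>2)))"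
    proof (rule E_mono)
      fix \<omega>
      have "(\<eta> d i \<omega>)\<^sup>2 \<le> real (card (nb d i)) * (\<Sum>j\<in>nb d i. (X j \<omega>)\<^sup>2)"
        using Cauchy_Schwarz_ineq_sum[of "\<lambda>_. 1" "\<lambda>j. X j \<omega>" "nb d i"] by (simp add: \<eta>_def)
      also have "\<dots> \<le> ?D * (\<Sum>j\<in>nb d i. (X j \<omega>)\<^sup>2)"
        by (intro mult_right_mono card_nb sum_nonneg) auto
      finally show "\<bar>X i \<omega>\<bar> * (\<eta> d i \<omega>)\<^sup>2 \<le> A * (?D * (\<Sum>j\<in>nb d i. (X j \<omega>)\<^sup>2))"
        using A_pos by (intro mult_mono bounded that) auto
    qed
    then show ?thesis
      by (simp add: E_sum mult.assoc)
  qed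
  then have "(\<Sum>i<N. E (\<lambda>\<omega>. \<bar>X i \<omega>\<bar> * (\<eta> d i \<omega>)\<^sup>2))
      \<le> (\<Sum>i<N. A * ?D * (\<Sum>j\<in>nb d i. E (\<lambda>\<omega>. (X j \<omega>)\<^sup>2)))"
    by (intro sum_mono) auto
  also have "\<dots> = A * ?D * (\<Sum>i<N. \<Sum>j\<in>nb d i. E (\<lambda>\<omega>. (X j \<omega>)\<^sup>2))"
    by (simp add: sum_distrib_left)
  also have "\<dots> \<le> A * ?D * (?D * V)"
    unfolding V_def using A_pos by (intro mult_left_mono sum_sum_nb_le E_nonneg) auto
  finally show ?thesis
    by (simp add: B_def power2_eq_square mult_ac)
qed

lemma E_abs_W_le: "E (\<lambda>\<omega>. \<bar>W \<omega>\<bar>) \<le> 1"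
proof -
  have "E (\<lambda>\<omega>. \<bar>W \<omega>\<bar>) \<le> E (\<lambda>\<omega>. 1 / 2 + (W \<omega>)\<^sup>2 / 2)"
  proof (rule E_mono)
    fix \<omega>
    show "\<bar>W \<omega>\<bar> \<le> 1 / 2 + (W \<omega>)\<^sup>2 / 2"
      using sum_squares_bound[of "\<bar>W \<omega>\<bar>" 1] by simp
  qed
  also have "\<dots> = 1"
    by (simp add: E_W_sq)
  finally show ?thesis .
qed

section \<open>Kolmogorov distance: concentration, smoothing and absorption\<close>

definition err :: "real \<Rightarrow> real" where
  "err z = \<bar>measure_pmf.prob M {\<omega>. W \<omega> \<le> z} - cdf std_normal_distribution z\<bar>"

text \<open>Concentration is borrowed from the normal law at the price of \<delta> at each endpoint.
  The slack c is there because \<open>W\<close> may have an atom at a, which a difference of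
  distribution functions taken at a would miss.\<close>

lemma prob_W_interval_le:
  assumes "\<And>z. err z \<le> \<delta>" "a \<le> b" "0 < c"
  shows "E (\<lambda>\<omega>. indicator {a..b} (W \<omega>)) \<le> 2 * \<delta> + (b - a + c) / 2"
proof -
  have "E (\<lambda>\<omega>. indicator {a..b} (W \<omega>)) \<le> E (\<lambda>\<omega>. indicator {\<omega>. W \<omega> \<le> b} \<omega> - indicator {\<omega>. W \<omega> \<le> a - c} \<omega>)"
    using assms by (intro E_mono) (auto simp: indicator_def)
  also have "\<dots> = measure_pmf.prob M {\<omega>. W \<omega> \<le> b} - measure_pmf.prob M {\<omega>. W \<omega> \<le> a - c}"
    by simp
  also have "\<dots> \<le> 2 * \<delta> + (cdf std_normal_distribution b - cdf std_normal_distribution (a - c))"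
    using assms(1)[of b] assms(1)[of "a - c"] unfolding err_def by linarith
  also have "\<dots> \<le> 2 * \<delta> + (b - (a - c)) / 2"
    using assms by (intro add_mono cdf_std_normal_diff_le) auto
  finally show ?thesis
    by (simp add: algebra_simps)
qed

text \<open>The subtracted terms have expectation 0, by independence of \<open>X i\<close> and
  \<open>W - \<eta> d i\<close>; they turn values of f into increments.\<close>

lemma stein_identity:
  "E (\<lambda>\<omega>. W \<omega> * f (W \<omega>)) = (\<Sum>i<N. E (\<lambda>\<omega>. X i \<omega> * (f (W \<omega>) - f (W \<omega> - \<eta> d i \<omega>))))"
proof -
  have "E (\<lambda>\<omega>. X i \<omega> * (f (W \<omega>) - f (W \<omega> - \<eta> d i \<omega>))) = E (\<lambda>\<omega>. X i \<omega> * f (W \<omega>))" if "i < N" for i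
    using E_X_mult_far[OF that, of f] by (simp add: right_diff_distrib)
  then have "(\<Sum>i<N. E (\<lambda>\<omega>. X i \<omega> * (f (W \<omega>) - f (W \<omega> - \<eta> d i \<omega>))))
      = (\<Sum>i<N. E (\<lambda>\<omega>. X i \<omega> * f (W \<omega>)))"
    by simp
  also have "\<dots> = E (\<lambda>\<omega>. \<Sum>i<N. X i \<omega> * f (W \<omega>))"
    by (rule E_sum[symmetric])
  also have "\<dots> = E (\<lambda>\<omega>. W \<omega> * f (W \<omega>))"
    by (simp only: W_def sum_distrib_right)
  finally show ?thesis ..
qed

text \<open>
  The weight \<open>\<bar>X\<^sub>i\<bar> \<eta>\<^sub>i\<^sup>2\<close> involves indices within distance \<open>d\<close> of \<open>i\<close>, so it is independent of
  \<open>W\<close> with the indices within distance \<open>2d\<close> removed; the removal shifts \<open>W\<close> by at most \<open>2B\<close>,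
  and a second shift returns to \<open>W\<close> itself.
\<close>

lemma E_local_weight_le:
  assumes \<delta>: "\<And>z. err z \<le> \<delta>" and "\<epsilon> > 0" and "i < N"
  shows "E (\<lambda>\<omega>. \<bar>X i \<omega>\<bar> * (\<eta> d i \<omega>)\<^sup>2 * (3 + 2 * \<bar>W \<omega>\<bar>
            + indicator {z - \<bar>\<eta> d i \<omega>\<bar>..z + \<epsilon> + \<bar>\<eta> d i \<omega>\<bar>} (W \<omega>) / \<epsilon>))
    \<le> E (\<lambda>\<omega>. \<bar>X i \<omega>\<bar> * (\<eta> d i \<omega>)\<^sup>2) * (5 + 8 * B + (2 * \<delta> + (\<epsilon> + 11 * B) / 2) / \<epsilon>)"
proof -
  define W' where "W' \<omega> = W \<omega> - \<eta> (2 * d) i \<omega>" for \<omega>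
  \<comment> \<open>The interval widens by B for the local sum and by 2B for passing to
    \<open>W'\<close>; the term 4B is twice the shift of |W|.\<close>
  define Q where "Q w = 3 + 4 * B + 2 * \<bar>w\<bar> + indicator {z - 3 * B..z + \<epsilon> + 3 * B} w / \<epsilon>" for w :: real
  have WW': "\<bar>W \<omega> - W' \<omega>\<bar> \<le> 2 * B" for \<omega>
    using abs_\<eta>_le_B(2)[of i \<omega>] by (simp add: W'_def)
  have "E (\<lambda>\<omega>. \<bar>X i \<omega>\<bar> * (\<eta> d i \<omega>)\<^sup>2 * (3 + 2 * \<bar>W \<omega>\<bar>
            + indicator {z - \<bar>\<eta> d i \<omega>\<bar>..z + \<epsilon> + \<bar>\<eta> d i \<omega>\<bar>} (W \<omega>) / \<epsilon>))
      \<le> E (\<lambda>\<omega>. \<bar>X i \<omega>\<bar> * (\<eta> d i \<omega>)\<^sup>2 * Q (W' \<omega>))"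
  proof (intro E_mono mult_left_mono)
    fix \<omega>
    have "indicator {z - \<bar>\<eta> d i \<omega>\<bar>..z + \<epsilon> + \<bar>\<eta> d i \<omega>\<bar>} (W \<omega>)
        \<le> (indicator {z - 3 * B..z + \<epsilon> + 3 * B} (W' \<omega>) :: real)"
      using WW'[of \<omega>] abs_\<eta>_le_B(1)[of i \<omega>] by (auto simp: indicator_def)
    then have "indicator {z - \<bar>\<eta> d i \<omega>\<bar>..z + \<epsilon> + \<bar>\<eta> d i \<omega>\<bar>} (W \<omega>) / \<epsilon>
        \<le> indicator {z - 3 * B..z + \<epsilon> + 3 * B} (W' \<omega>) / \<epsilon>"
      using \<open>\<epsilon> > 0\<close> by (intro divide_right_mono) auto
    moreover have "\<bar>W \<omega>\<bar> \<le> \<bar>W' \<omega>\<bar> + 2 * B"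
      using WW'[of \<omega>] by linarith
    ultimately show "3 + 2 * \<bar>W \<omega>\<bar>
        + indicator {z - \<bar>\<eta> d i \<omega>\<bar>..z + \<epsilon> + \<bar>\<eta> d i \<omega>\<bar>} (W \<omega>) / \<epsilon> \<le> Q (W' \<omega>)"
      by (simp add: Q_def)
  qed auto
  also have "\<dots> = E (\<lambda>\<omega>. \<bar>X i \<omega>\<bar> * (\<eta> d i \<omega>)\<^sup>2) * E (\<lambda>\<omega>. Q (W' \<omega>))"
    unfolding W'_def W_minus_\<eta> \<eta>_def [of d]
  proof (rule expectation_mult_indep[of "i - d" "i + d + 1"
        "\<lambda>x. \<bar>x i\<bar> * (\<Sum>j\<in>nb d i. x j)\<^sup>2" "\<lambda>x. Q (\<Sum>j\<in>{..<N} - nb (2 * d) i. x j)"])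
    fix x y :: "nat \<Rightarrow> real"
    assume eq: "\<And>j. i - d \<le> j \<Longrightarrow> j < i + d + 1 \<Longrightarrow> x j = y j"
    have "x i = y i"
      by (rule eq) auto
    moreover have "(\<Sum>j\<in>nb d i. x j) = (\<Sum>j\<in>nb d i. y j)"
      by (rule sum.cong[OF refl]) (rule eq; auto simp: nb_def)
    ultimately show "\<bar>x i\<bar> * (\<Sum>j\<in>nb d i. x j)\<^sup>2 = \<bar>y i\<bar> * (\<Sum>j\<in>nb d i. y j)\<^sup>2"
      by simp
  next
    fix x y :: "nat \<Rightarrow> real"
    assume eq: "\<And>j. j + d < i - d \<or> i + d + 1 + d \<le> j \<Longrightarrow> x j = y j"
    have "(\<Sum>j\<in>{..<N} - nb (2 * d) i. x j) = (\<Sum>j\<in>{..<N} - nb (2 * d) i. y j)"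
      by (rule sum.cong[OF refl]) (rule eq; auto simp: nb_def)
    then show "Q (\<Sum>j\<in>{..<N} - nb (2 * d) i. x j) = Q (\<Sum>j\<in>{..<N} - nb (2 * d) i. y j)"
      by simp
  qed simp
  also have "\<dots> \<le> E (\<lambda>\<omega>. \<bar>X i \<omega>\<bar> * (\<eta> d i \<omega>)\<^sup>2) * (5 + 8 * B + (2 * \<delta> + (\<epsilon> + 11 * B) / 2) / \<epsilon>)"
  proof (rule mult_left_mono)
    have "E (\<lambda>\<omega>. Q (W' \<omega>)) \<le> E (\<lambda>\<omega>. 3 + 8 * B + 2 * \<bar>W \<omega>\<bar>
        + indicator {z - 5 * B..z + \<epsilon> + 5 * B} (W \<omega>) / \<epsilon>)"
    proof (rule E_mono)
      fix \<omega>
      have "indicator {z - 3 * B..z + \<epsilon> + 3 * B} (W' \<omega>)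
          \<le> (indicator {z - 5 * B..z + \<epsilon> + 5 * B} (W \<omega>) :: real)"
        using WW'[of \<omega>] by (auto simp: indicator_def)
      then have "indicator {z - 3 * B..z + \<epsilon> + 3 * B} (W' \<omega>) / \<epsilon>
          \<le> indicator {z - 5 * B..z + \<epsilon> + 5 * B} (W \<omega>) / \<epsilon>"
        using \<open>\<epsilon> > 0\<close> by (intro divide_right_mono) auto
      moreover have "\<bar>W' \<omega>\<bar> \<le> \<bar>W \<omega>\<bar> + 2 * B"
        using WW'[of \<omega>] by linarith
      ultimately show "Q (W' \<omega>) \<le> 3 + 8 * B + 2 * \<bar>W \<omega>\<bar>
          + indicator {z - 5 * B..z + \<epsilon> + 5 * B} (W \<omega>) / \<epsilon>"
        by (simp add: Q_def)
    qed
    also have "\<dots> = 3 + 8 * B + 2 * E (\<lambda>\<omega>. \<bar>W \<omega>\<bar>)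
        + E (\<lambda>\<omega>. indicator {z - 5 * B..z + \<epsilon> + 5 * B} (W \<omega>)) / \<epsilon>"
      by simp
    \<comment> \<open>The slack in the concentration bound is B, which together with the widening by
      5B on either side makes 11B.\<close>
    also have "\<dots> \<le> 3 + 8 * B + 2 * 1
        + (2 * \<delta> + ((z + \<epsilon> + 5 * B) - (z - 5 * B) + B) / 2) / \<epsilon>"
      using E_abs_W_le B_pos \<open>\<epsilon> > 0\<close>
      by (intro add_mono mult_left_mono divide_right_mono prob_W_interval_le \<delta>) auto
    finally show "E (\<lambda>\<omega>. Q (W' \<omega>)) \<le> 5 + 8 * B + (2 * \<delta> + (\<epsilon> + 11 * B) / 2) / \<epsilon>"
      by (simp add: algebra_simps)
  qed (auto intro!: E_nonneg)
  finally show ?thesis .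
qed

text \<open>
  The width \<open>4B\<close> makes the coefficient of \<open>\<delta>\<close> equal to \<open>1/2\<close>, so that the supremum of
  \<open>err\<close> can be absorbed into the left-hand side.
\<close>

lemma stein_ramp_bound:
  assumes \<delta>: "\<And>z. err z \<le> \<delta>" and B: "B \<le> 1 / 28"
  shows "\<bar>E (\<lambda>\<omega>. ramp z (4 * B) (W \<omega>)) - (LINT t|std_normal_distribution. ramp z (4 * B) t)\<bar>
    \<le> 12 * B + \<delta> / 2"
proof -
  let ?\<epsilon> = "4 * B"
  define c where "c = (LINT t|std_normal_distribution. ramp z ?\<epsilon> t)"
  have \<epsilon>: "?\<epsilon> > 0"
    using B_pos by simp
  obtain f where f: "\<And>x. (f has_real_derivative x * f x + (ramp z ?\<epsilon> x - c)) (at x)"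
    "\<And>x. \<bar>x * f x + (ramp z ?\<epsilon> x - c)\<bar> \<le> 2" "\<And>x. \<bar>f x\<bar> \<le> 3"
    using stein_solution_exists[of "ramp z ?\<epsilon>", OF continuous_on_ramp ramp_bounds] unfolding c_def by blast
  define g where "g x = x * f x + (ramp z ?\<epsilon> x - c)" for x
  let ?q = "\<lambda>i \<omega>. 3 + 2 * \<bar>W \<omega>\<bar>
            + indicator {z - \<bar>\<eta> d i \<omega>\<bar>..z + ?\<epsilon> + \<bar>\<eta> d i \<omega>\<bar>} (W \<omega>) / ?\<epsilon>"
  let ?r = "\<lambda>i \<omega>. \<eta> d i \<omega> * g (W \<omega>) - (f (W \<omega>) - f (W \<omega> - \<eta> d i \<omega>))"
  \<comment> \<open>By the Stein equation the smoothed error is the mean of f'(W) - W f(W). The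
    linear part of the increments in \<open>stein_identity\<close> leaves f'(W) times 1 minus the
    quadratic form; what remains is the second-order remainder \<open>?r\<close>.\<close>
  have "E (\<lambda>\<omega>. ramp z ?\<epsilon> (W \<omega>)) - c = E (\<lambda>\<omega>. g (W \<omega>)) - E (\<lambda>\<omega>. W \<omega> * f (W \<omega>))"
    by (simp add: g_def)
  also have "\<dots> = E (\<lambda>\<omega>. g (W \<omega>) * (1 - (\<Sum>i<N. X i \<omega> * \<eta> d i \<omega>)))
      + (E (\<lambda>\<omega>. \<Sum>i<N. X i \<omega> * \<eta> d i \<omega> * g (W \<omega>)) - E (\<lambda>\<omega>. W \<omega> * f (W \<omega>)))"
    by (simp add: right_diff_distrib sum_distrib_left mult_ac)
  also have "E (\<lambda>\<omega>. \<Sum>i<N. X i \<omega> * \<eta> d i \<omega> * g (W \<omega>)) - E (\<lambda>\<omega>. W \<omega> * f (W \<omega>))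
      = (\<Sum>i<N. E (\<lambda>\<omega>. X i \<omega> * ?r i \<omega>))"
    unfolding stein_identity E_sum sum_subtractf[symmetric]
    by (simp add: right_diff_distrib mult.assoc)
  finally have split: "E (\<lambda>\<omega>. ramp z ?\<epsilon> (W \<omega>)) - c
      = E (\<lambda>\<omega>. g (W \<omega>) * (1 - (\<Sum>i<N. X i \<omega> * \<eta> d i \<omega>))) + (\<Sum>i<N. E (\<lambda>\<omega>. X i \<omega> * ?r i \<omega>))" .
  have R1: "\<bar>E (\<lambda>\<omega>. g (W \<omega>) * (1 - (\<Sum>i<N. X i \<omega> * \<eta> d i \<omega>)))\<bar> \<le> 4 * B"
  proof -
    have "\<bar>E (\<lambda>\<omega>. g (W \<omega>) * (1 - (\<Sum>i<N. X i \<omega> * \<eta> d i \<omega>)))\<bar>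
        \<le> E (\<lambda>\<omega>. \<bar>g (W \<omega>) * (1 - (\<Sum>i<N. X i \<omega> * \<eta> d i \<omega>))\<bar>)"
      by (rule E_abs_le)
    also have "\<dots> \<le> E (\<lambda>\<omega>. 2 * \<bar>1 - (\<Sum>i<N. X i \<omega> * \<eta> d i \<omega>)\<bar>)"
      unfolding abs_mult using f(2) by (intro E_mono mult_right_mono) (auto simp: g_def)
    finally show ?thesis
      using E_abs_quadratic_deviation by simp
  qed
  have "\<bar>\<Sum>i<N. E (\<lambda>\<omega>. X i \<omega> * ?r i \<omega>)\<bar> \<le> (\<Sum>i<N. \<bar>E (\<lambda>\<omega>. X i \<omega> * ?r i \<omega>)\<bar>)"
    by (rule sum_abs)
  also have "\<dots> \<le> (\<Sum>i<N. E (\<lambda>\<omega>. \<bar>X i \<omega>\<bar> * (\<eta> d i \<omega>)\<^sup>2) *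
      (5 + 8 * B + (2 * \<delta> + (?\<epsilon> + 11 * B) / 2) / ?\<epsilon>))"
  proof (rule sum_mono)
    fix i assume i: "i \<in> {..<N}"
    have "\<bar>E (\<lambda>\<omega>. X i \<omega> * ?r i \<omega>)\<bar> \<le> E (\<lambda>\<omega>. \<bar>X i \<omega> * ?r i \<omega>\<bar>)"
      by (rule E_abs_le)
    also have "\<dots> \<le> E (\<lambda>\<omega>. \<bar>X i \<omega>\<bar> * ((\<eta> d i \<omega>)\<^sup>2 * ?q i \<omega>))"
      unfolding abs_mult g_def using f \<epsilon> by (intro E_mono mult_left_mono stein_remainder_le) auto
    also have "\<dots> = E (\<lambda>\<omega>. \<bar>X i \<omega>\<bar> * (\<eta> d i \<omega>)\<^sup>2 * ?q i \<omega>)"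
      by (simp only: mult.assoc)
    also have "\<dots> \<le> E (\<lambda>\<omega>. \<bar>X i \<omega>\<bar> * (\<eta> d i \<omega>)\<^sup>2) *
        (5 + 8 * B + (2 * \<delta> + (?\<epsilon> + 11 * B) / 2) / ?\<epsilon>)"
      using i \<epsilon> by (intro E_local_weight_le \<delta>) auto
    finally show "\<bar>E (\<lambda>\<omega>. X i \<omega> * ?r i \<omega>)\<bar> \<le> E (\<lambda>\<omega>. \<bar>X i \<omega>\<bar> * (\<eta> d i \<omega>)\<^sup>2) *
        (5 + 8 * B + (2 * \<delta> + (?\<epsilon> + 11 * B) / 2) / ?\<epsilon>)" .
  qed
  also have "\<dots> = (\<Sum>i<N. E (\<lambda>\<omega>. \<bar>X i \<omega>\<bar> * (\<eta> d i \<omega>)\<^sup>2)) *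
      (5 + 8 * B + (2 * \<delta> + (?\<epsilon> + 11 * B) / 2) / ?\<epsilon>)"
    by (rule sum_distrib_right[symmetric])
  also have "\<dots> \<le> B * (5 + 8 * B + (2 * \<delta> + (?\<epsilon> + 11 * B) / 2) / ?\<epsilon>)"
  proof (rule mult_right_mono[OF sum_E_abs_X\<eta>_sq])
    have "0 \<le> \<delta>"
      using \<delta>[of 0] by (simp add: err_def)
    then show "0 \<le> 5 + 8 * B + (2 * \<delta> + (?\<epsilon> + 11 * B) / 2) / ?\<epsilon>"
      using B_pos by (intro add_nonneg_nonneg divide_nonneg_nonneg) auto
  qed
  also have "\<dots> = 5 * B + 8 * B * B + \<delta> / 2 + 15 / 8 * B"
    using B_pos by (simp add: field_simps)
  \<comment> \<open>The assumption on \<open>B\<close> linearizes the quadratic term; 5 + 8/28 +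
    15/8 is less than 8.\<close>
  also have "\<dots> \<le> 5 * B + 8 * B * (1 / 28) + \<delta> / 2 + 15 / 8 * B"
    using B B_pos by (intro add_mono mult_left_mono) auto
  also have "\<dots> \<le> 8 * B + \<delta> / 2"
    using B_pos by simp
  finally have "\<bar>\<Sum>i<N. E (\<lambda>\<omega>. X i \<omega> * ?r i \<omega>)\<bar> \<le> 8 * B + \<delta> / 2" .
  then show ?thesis
    unfolding c_def[symmetric] split using R1 by linarith
qed

text \<open>The indicator of the half-line up to z lies between the ramps starting at z - 4B and at
  z. On the normal side the shift by 4B costs 2B, which is added to the 12B of the smoothed
  comparison.\<close>

lemma err_le_half:
  assumes \<delta>: "\<And>z. err z \<le> \<delta>" and B: "B \<le> 1 / 28"
  shows "err z \<le> 14 * B + \<delta> / 2"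
proof -
  interpret N: real_distribution std_normal_distribution
    by (rule real_dist_normal_dist)
  let ?\<epsilon> = "4 * B" and ?\<Phi> = "cdf std_normal_distribution"
  let ?n = "\<lambda>z. LINT t|std_normal_distribution. ramp z ?\<epsilon> t"
  have \<epsilon>: "?\<epsilon> > 0"
    using B_pos by simp
  have P: "measure_pmf.prob M {\<omega>. W \<omega> \<le> y} = E (\<lambda>\<omega>. indicator {..y} (W \<omega>))" for y
  proof -
    have "E (\<lambda>\<omega>. indicator {..y} (W \<omega>)) = E (indicator {\<omega>. W \<omega> \<le> y})"
      by (intro Bochner_Integration.integral_cong) (auto simp: indicator_def)
    then show ?thesis
      by simp
  qed
  have \<Phi>: "?\<Phi> y = (LINT t|std_normal_distribution. indicator {..y} t)" for y
    by (simp add: cdf_def2)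
  have meas: "ramp y ?\<epsilon> \<in> borel_measurable borel" for y
    by (intro borel_measurable_continuous_onI continuous_on_ramp)
  have ramp_int: "integrable std_normal_distribution (ramp y ?\<epsilon>)" for y
    using ramp_bounds meas by (intro N.integrable_const_bound[of _ 1]) auto
  have ind_int: "integrable std_normal_distribution (indicator {..y} :: real \<Rightarrow> real)" for y
    by (rule N.integrable_const_bound[of _ 1]) auto
  have ramp_upper: "?n y \<le> ?\<Phi> (y + ?\<epsilon>)" for y
    unfolding \<Phi> by (intro integral_mono ramp_int ind_int ramp_le_indicator \<epsilon>)
  have ramp_lower: "?\<Phi> y \<le> ?n y" for y
    unfolding \<Phi> by (intro integral_mono ramp_int ind_int indicator_le_ramp \<epsilon>)
  have "measure_pmf.prob M {\<omega>. W \<omega> \<le> z} \<le> E (\<lambda>\<omega>. ramp z ?\<epsilon> (W \<omega>))"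
    unfolding P using \<epsilon> by (intro E_mono indicator_le_ramp)
  moreover have "E (\<lambda>\<omega>. ramp (z - ?\<epsilon>) ?\<epsilon> (W \<omega>)) \<le> measure_pmf.prob M {\<omega>. W \<omega> \<le> z}"
    unfolding P using ramp_le_indicator[OF \<epsilon>, of "z - ?\<epsilon>"] by (intro E_mono) simp
  moreover have "?\<Phi> (z + ?\<epsilon>) - ?\<Phi> z \<le> 2 * B" "?\<Phi> z - ?\<Phi> (z - ?\<epsilon>) \<le> 2 * B"
    using cdf_std_normal_diff_le[of z "z + ?\<epsilon>"] cdf_std_normal_diff_le[of "z - ?\<epsilon>" z] B_pos by simp_all
  ultimately show ?thesis
    using stein_ramp_bound[OF \<delta> B, of z] stein_ramp_bound[OF \<delta> B, of "z - ?\<epsilon>"]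
      ramp_upper[of z] ramp_lower[of "z - ?\<epsilon>"]
    unfolding err_def abs_le_iff by linarith
qed

text \<open>The supremum \<delta> of \<open>err\<close> is at most 1, hence finite, so \<delta> <=
  14B + \<delta>/2 can be solved for \<delta>. If B exceeds 1/28, the claimed bound is larger than 1
  and the estimate is trivial.\<close>

theorem berry_esseen:
  "\<bar>measure_pmf.prob M {\<omega>. (\<Sum>i<N. X i \<omega>) \<le> z} - cdf std_normal_distribution z\<bar>
    \<le> 28 * ((2 * real d + 1)\<^sup>2 * (\<Sum>i<N. E (\<lambda>\<omega>. (X i \<omega>)\<^sup>2)) * A)"
proof -
  interpret N: real_distribution std_normal_distribution
    by (rule real_dist_normal_dist)
  have err1: "err y \<le> 1" for y
    using N.cdf_nonneg[of y] N.cdf_bounded_prob[of y]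
      measure_pmf.prob_le_1[of M "{\<omega>. W \<omega> \<le> y}"] measure_nonneg[of M "{\<omega>. W \<omega> \<le> y}"]
    unfolding err_def by linarith
  have "err z \<le> 28 * B"
  proof (cases "B \<le> 1 / 28")
    case True
    have bdd: "bdd_above (range err)"
      using err1 by (intro bdd_aboveI[of _ 1]) auto
    define \<delta> where "\<delta> = (SUP y. err y)"
    have \<delta>: "err y \<le> \<delta>" for y
      unfolding \<delta>_def by (rule cSUP_upper[OF _ bdd]) simp
    have "\<delta> \<le> 14 * B + \<delta> / 2"
      unfolding \<delta>_def by (intro cSUP_least) (use err_le_half[OF \<delta> True] in \<open>auto simp: \<delta>_def\<close>)
    then show ?thesis
      using \<delta>[of z] by linarith
  next
    case False
    then show ?thesis
      using err1[of z] by linarith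
  qed
  then show ?thesis
    by (simp add: err_def W_def B_def V_def)
qed

end

section \<open>Standardized factors of Mallows permutations\<close>

lemma length_st [simp]: "length (st w) = length w"
  by (simp add: st_def)

lemma length_Sym: "w \<in> Sym n \<Longrightarrow> length w = n"
  by (simp add: length_finite_permutations_of_set)

text \<open>Counting positions instead of letters allows ranks in two order-isomorphic words with
  different letters to be compared.\<close>

lemma nth_st:
  assumes "distinct w" "i < length w"
  shows "st w ! i = card {j. j < length w \<and> w ! j \<le> w ! i}"
proof -
  have "{y \<in> set w. y \<le> w ! i} = (!) w ` {j. j < length w \<and> w ! j \<le> w ! i}"
    by (auto simp: in_set_conv_nth)
  moreover have "inj_on ((!) w) {j. j < length w \<and> w ! j \<le> w ! i}"
    using assms by (auto simp: inj_on_def nth_eq_iff_index_eq)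
  ultimately show ?thesis
    using assms by (simp add: st_def card_image)
qed

lemma st_cong:
  assumes "distinct v" "distinct w" "length v = length w"
    and iso: "\<And>i j. i < length w \<Longrightarrow> j < length w \<Longrightarrow> v ! i < v ! j \<longleftrightarrow> w ! i < w ! j"
  shows "st v = st w"
proof (rule nth_equalityI)
  fix i assume "i < length (st v)"
  then have i: "i < length v" "i < length w"
    using assms(3) by simp_all
  have "{j. j < length v \<and> v ! j \<le> v ! i} = {j. j < length w \<and> w ! j \<le> w ! i}"
    using iso[OF i(2)] assms(3) by (metis linorder_not_less)
  then show "st v ! i = st w ! i"
    using i assms by (simp add: nth_st)
qed (use assms in simp)

lemma distinct_st: "distinct w \<Longrightarrow> distinct (st w)"
  using st_in_Sym permutations_of_setD(2) by blast

lemma length_factor: "length (factor j k w) = min k (length w - j)"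
  by (simp add: factor_def)

lemma distinct_factor: "distinct w \<Longrightarrow> distinct (factor j k w)"
  by (simp add: factor_def)

lemma nth_factor: "i < length (factor j k w) \<Longrightarrow> factor j k w ! i = w ! (j + i)"
  by (cases "j \<le> length w") (simp_all add: factor_def)

text \<open>Standardizing preserves the relative order of all letters, so a window has the same
  pattern before and after. This lets windows of a half be read from its standardization.\<close>

lemma st_factor_st:
  assumes "distinct w"
  shows "st (factor j k (st w)) = st (factor j k w)"
proof (rule st_cong)
  fix a b assume "a < length (factor j k w)" "b < length (factor j k w)"
  then have "j + a < length w" "j + b < length w"
    "a < length (factor j k (st w))" "b < length (factor j k (st w))"
    by (auto simp: length_factor)
  then show "factor j k (st w) ! a < factor j k (st w) ! b \<longleftrightarrow>
      factor j k w ! a < factor j k w ! b"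
    using \<open>a < length (factor j k w)\<close> \<open>b < length (factor j k w)\<close>
    by (simp add: nth_factor st_order_iso)
qed (use assms in \<open>auto simp: length_factor intro: distinct_factor distinct_st\<close>)

lemma take_eq_factor: "take a w = factor 0 a w"
  by (simp add: factor_def)

lemma factor_factor: "i + k \<le> l \<Longrightarrow> factor i k (factor j l w) = factor (j + i) k w"
  by (simp add: factor_def drop_take min_def add.commute)

section \<open>Splitting a Mallows permutation at a position\<close>

lemma inversions_st: "inversions (st w) = inversions w"
proof -
  have "{(i, j). i < j \<and> j < length (st w) \<and> st w ! i > st w ! j}
      = {(i, j). i < j \<and> j < length w \<and> w ! i > w ! j}"
    by (auto simp: st_order_iso)
  then show ?thesis
    by (simp add: inversions_def)
qed

text \<open>The cross term depends on the two words only through their letter sets, which is what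
  makes the Mallows weight factor.\<close>

lemma inversions_append:
  assumes "distinct (u @ v)"
  shows "inversions (u @ v) =
    inversions u + inversions v + card {(x, y). x \<in> set u \<and> y \<in> set v \<and> y < x}"
  using assms
proof (induction u)
  case (Cons x u)
  have fin: "finite {(x, y). x \<in> set u \<and> y \<in> set v \<and> y < x}"
    by (rule finite_subset[of _ "set u \<times> set v"]) auto
  have "{(z, y). z \<in> set (x # u) \<and> y \<in> set v \<and> y < z}
      = Pair x ` {y \<in> set v. y < x} \<union> {(x, y). x \<in> set u \<and> y \<in> set v \<and> y < x}"
    by auto
  also have "card \<dots> = card (Pair x ` {y \<in> set v. y < x})
      + card {(x, y). x \<in> set u \<and> y \<in> set v \<and> y < x}"
    using Cons.prems fin by (intro card_Un_disjoint) auto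
  also have "card (Pair x ` {y \<in> set v. y < x}) = card {y \<in> set v. y < x}"
    by (intro card_image) (auto simp: inj_on_def)
  finally have cross: "card {(z, y). z \<in> set (x # u) \<and> y \<in> set v \<and> y < z}
      = card {y \<in> set v. y < x} + card {(x, y). x \<in> set u \<and> y \<in> set v \<and> y < x}" .
  have "{y \<in> set (u @ v). y < x} = {y \<in> set u. y < x} \<union> {y \<in> set v. y < x}"
    by auto
  also have "card \<dots> = card {y \<in> set u. y < x} + card {y \<in> set v. y < x}"
    using Cons.prems by (intro card_Un_disjoint) auto
  finally have "card {y \<in> set (u @ v). y < x}
      = card {y \<in> set u. y < x} + card {y \<in> set v. y < x}" .
  moreover have "inversions (x # u @ v) = card {y \<in> set (u @ v). y < x} + inversions (u @ v)"
    using Cons.prems by (intro inversions_Cons) simp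
  moreover have "inversions (x # u) = card {y \<in> set u. y < x} + inversions u"
    using Cons.prems by (intro inversions_Cons) simp
  ultimately show ?case
    using Cons cross by simp
qed simp

text \<open>The rank within the common letter set is injective on it, so equal ranks mean equal
  letters.\<close>

lemma eq_of_set_eq_st_eq:
  assumes "set u = set v" "st u = st v"
  shows "u = v"
proof -
  let ?r = "\<lambda>x. card {y \<in> set v. y \<le> x}"
  have "inj_on ?r (set u \<union> set v)"
    using assms card_rank_le_bij[of "set v"] by (simp add: bij_betw_def)
  moreover have "map ?r u = map ?r v"
    using assms by (simp add: st_def)
  ultimately show ?thesis
    by (simp add: inj_on_map_eq_map)
qed

lemma set_mallows: "q > 0 \<Longrightarrow> set_pmf (mallows n q) = Sym n"
  using qfact_pos[of q n] by (auto simp: set_pmf_eq pmf_mallows)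

text \<open>The set of left letters determines that of the right letters, and a word is recovered
  from its letter set and its pattern; this gives injectivity. Surjectivity follows by counting: (a
  + b)! is a! b! times a binomial coefficient.\<close>

lemma bij_betw_split_Sym:
  "bij_betw (\<lambda>w. (st (take a w), st (drop a w), set (take a w))) (Sym (a + b))
     (Sym a \<times> Sym b \<times> {B. B \<subseteq> {1..a + b} \<and> card B = a})"
  (is "bij_betw ?F ?S ?T")
proof -
  have inj: "inj_on ?F ?S"
  proof (rule inj_onI)
    fix v w assume v: "v \<in> ?S" and w: "w \<in> ?S" and eq: "?F v = ?F w"
    have eqs: "st (take a v) = st (take a w)" "st (drop a v) = st (drop a w)"
      "set (take a v) = set (take a w)"
      using eq by blast+
    have 1: "take a v = take a w"
      using eqs(3,1) by (rule eq_of_set_eq_st_eq)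
    have "set (drop a x) = {1..a + b} - set (take a x)" if "x \<in> ?S" for x
      using permutations_of_setD[OF that] set_append[of "take a x" "drop a x"]
        distinct_append[of "take a x" "drop a x"] by auto
    then have "set (drop a v) = set (drop a w)"
      using eqs(3) v w by metis
    then have "drop a v = drop a w"
      using eqs(2) by (rule eq_of_set_eq_st_eq)
    with 1 show "v = w"
      by (metis append_take_drop_id)
  qed
  have "?F ` ?S \<subseteq> ?T"
  proof (rule image_subsetI)
    fix w assume w: "w \<in> ?S"
    have "st (take a w) \<in> Sym a" "st (drop a w) \<in> Sym b"
      using st_in_Sym[of "take a w"] st_in_Sym[of "drop a w"] permutations_of_setD[OF w]
        length_Sym[OF w] by simp_all
    moreover have "set (take a w) \<subseteq> {1..a + b}" "card (set (take a w)) = a"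
      using permutations_of_setD[OF w] set_take_subset[of a w] length_Sym[OF w]
      by (auto simp: distinct_card)
    ultimately show "?F w \<in> ?T"
      by blast
  qed
  moreover have fin: "finite {B. B \<subseteq> {1..a + b} \<and> card B = a}"
    by (rule finite_subset[of _ "Pow {1..a + b}"]) auto
  moreover have "card ?T = card ?S"
    using binomial_fact_lemma[of a "a + b"] n_subsets[of "{1..a + b}" a]
    by (simp add: card_cartesian_product mult.assoc)
  ultimately have "?F ` ?S = ?T"
    using inj by (intro card_subset_eq) (auto simp: card_image)
  with inj show ?thesis
    by (simp add: bij_betw_def)
qed

text \<open>Both mass functions sum to 1, which forces c = 1.\<close>

lemma pmf_eq_of_proportional:
  assumes "finite (set_pmf P)" "finite (set_pmf Q)" and proportional: "\<And>x. pmf P x = c * pmf Q x"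
  shows "P = Q"
proof -
  let ?A = "set_pmf P \<union> set_pmf Q"
  have "1 = (\<Sum>x\<in>?A. pmf P x)"
    using assms by (subst sum_pmf_eq_1) auto
  also have "\<dots> = c * (\<Sum>x\<in>?A. pmf Q x)"
    by (simp add: proportional sum_distrib_left)
  also have "\<dots> = c"
    using assms by (subst sum_pmf_eq_1) auto
  finally show ?thesis
    by (intro pmf_eqI) (simp add: proportional)
qed

text \<open>The words with given patterns u and v correspond to the sets of left letters. Their
  weights are a factor depending on u and v times q to the cross inversions of the set, so summing
  over the sets leaves a product weight.\<close>

theorem map_pmf_split_mallows:
  assumes "q > 0"
  shows "map_pmf (\<lambda>w. (st (take a w), st (drop a w))) (mallows (a + b) q)
    = pair_pmf (mallows a q) (mallows b q)"
proof -
  let ?n = "a + b"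
  let ?S = "{B. B \<subseteq> {1..?n} \<and> card B = a}"
  let ?F = "\<lambda>w. (st (take a w), st (drop a w))"
  define cross where "cross B = card {(x, y). x \<in> B \<and> y \<in> {1..?n} - B \<and> y < x}" for B :: "nat set"
  note bij = bij_betw_split_Sym[of a b]
  have inv: "inversions w = inversions (st (take a w)) + inversions (st (drop a w))
      + cross (set (take a w))" if "w \<in> Sym ?n" for w
  proof -
    have "set (drop a w) = {1..?n} - set (take a w)"
      using permutations_of_setD[OF that] set_append[of "take a w" "drop a w"]
        distinct_append[of "take a w" "drop a w"] by auto
    then show ?thesis
      using inversions_append[of "take a w" "drop a w"] permutations_of_setD[OF that]
      by (simp add: inversions_st cross_def)
  qed
  \<comment> \<open>Everything independent of u and v: the sum over letter sets, and the ratio of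
    the normalizing constants.\<close>
  define K where "K = (\<Sum>B\<in>?S. q ^ cross B) / qfact q ?n * qfact q a * qfact q b"
  have "pmf (map_pmf ?F (mallows ?n q)) (u, v) = K * pmf (pair_pmf (mallows a q) (mallows b q)) (u, v)"
    for u v
  proof (cases "u \<in> Sym a \<and> v \<in> Sym b")
    case True
    let ?W = "{w \<in> Sym ?n. ?F w = (u, v)}"
    have bijW: "bij_betw (\<lambda>w. set (take a w)) ?W ?S"
    proof (rule bij_betw_imageI)
      show "inj_on (\<lambda>w. set (take a w)) ?W"
        using bij_betw_imp_inj_on[OF bij] by (auto simp: inj_on_def)
      show "(\<lambda>w. set (take a w)) ` ?W = ?S"
      proof
        show "(\<lambda>w. set (take a w)) ` ?W \<subseteq> ?S"
          using bij_betw_imp_surj_on[OF bij] by blast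
        show "?S \<subseteq> (\<lambda>w. set (take a w)) ` ?W"
        proof
          fix B assume "B \<in> ?S"
          then have "(u, v, B) \<in> (\<lambda>w. (st (take a w), st (drop a w), set (take a w))) ` Sym ?n"
            unfolding bij_betw_imp_surj_on[OF bij] using True by blast
          then show "B \<in> (\<lambda>w. set (take a w)) ` ?W"
            by auto
        qed
      qed
    qed
    have "pmf (map_pmf ?F (mallows ?n q)) (u, v)
        = measure (measure_pmf (mallows ?n q)) (?F -` {(u, v)} \<inter> set_pmf (mallows ?n q))"
      by (simp add: pmf_map measure_Int_set_pmf)
    also have "?F -` {(u, v)} \<inter> set_pmf (mallows ?n q) = ?W"
      using assms by (auto simp: set_mallows)
    also have "measure (measure_pmf (mallows ?n q)) ?W = (\<Sum>w\<in>?W. pmf (mallows ?n q) w)"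
      by (intro measure_measure_pmf_finite) simp
    also have "\<dots> = (\<Sum>w\<in>?W. q ^ (inversions u + inversions v + cross (set (take a w))) / qfact q ?n)"
      by (intro sum.cong) (auto simp: pmf_mallows assms inv)
    also have "\<dots> = (\<Sum>B\<in>?S. q ^ (inversions u + inversions v + cross B) / qfact q ?n)"
      by (rule sum.reindex_bij_betw[OF bijW])
    also have "\<dots> = q ^ inversions u * q ^ inversions v * (\<Sum>B\<in>?S. q ^ cross B) / qfact q ?n"
      by (simp add: power_add sum_distrib_left sum_divide_distrib)
    also have "\<dots> = K * pmf (pair_pmf (mallows a q) (mallows b q)) (u, v)"
      using True assms qfact_pos[OF assms, of a] qfact_pos[OF assms, of b]
      by (simp add: pmf_pair pmf_mallows K_def)
    finally show ?thesis .
  next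
    case False
    have "(u, v) \<notin> ?F ` set_pmf (mallows ?n q)"
      using False bij_betw_imp_surj_on[OF bij] assms by (auto simp: set_mallows)
    then have "pmf (map_pmf ?F (mallows ?n q)) (u, v) = 0"
      by (rule pmf_map_outside)
    then show ?thesis
      using False assms by (auto simp: pmf_pair pmf_mallows)
  qed
  then show ?thesis
    by (intro pmf_eq_of_proportional[where c = K]) (auto simp: set_mallows assms)
qed

text \<open>Projecting the product law to its components shows that a prefix or suffix of a Mallows
  permutation is again Mallows after standardization; a window is a prefix of a suffix.\<close>

lemma map_pmf_st_factor_mallows:
  assumes "q > 0" "j + k \<le> n"
  shows "map_pmf (\<lambda>w. st (factor j k w)) (mallows n q) = mallows k q"
proof -
  have take: "map_pmf (\<lambda>w. st (take a w)) (mallows (a + b) q) = mallows a q" for a b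
    using arg_cong[OF map_pmf_split_mallows[OF assms(1), of a b], of "map_pmf fst"]
    by (simp add: map_pmf_comp map_fst_pair_pmf)
  have drop: "map_pmf (\<lambda>w. st (drop a w)) (mallows (a + b) q) = mallows b q" for a b
    using arg_cong[OF map_pmf_split_mallows[OF assms(1), of a b], of "map_pmf snd"]
    by (simp add: map_pmf_comp map_snd_pair_pmf)
  have "map_pmf (\<lambda>w. st (factor j k w)) (mallows n q)
      = map_pmf (\<lambda>w. st (take k w)) (map_pmf (\<lambda>w. st (drop j w)) (mallows n q))"
    unfolding map_pmf_comp
  proof (rule map_pmf_cong[OF refl])
    fix w assume "w \<in> set_pmf (mallows n q)"
    then have "distinct (drop j w)"
      using assms by (auto simp: set_mallows dest: permutations_of_setD)
    then show "st (factor j k w) = st (take k (st (drop j w)))"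
      using st_factor_st[of "drop j w" 0 k] by (simp add: factor_def)
  qed
  also have "\<dots> = mallows k q"
    using drop[of j "n - j"] take[of k "n - j - k"] assms by simp
  finally show ?thesis .
qed

section \<open>Dependence range of window functions\<close>

lemma m_dependent_mult_expectation:
  assumes "m_dependent d M X" "finite (set_pmf M)" "i + d < j"
  shows "measure_pmf.expectation M (\<lambda>\<omega>. X i \<omega> * X j \<omega>)
    = measure_pmf.expectation M (X i) * measure_pmf.expectation M (X j)"
proof -
  have "map_pmf (\<lambda>\<omega>. (X i \<omega>, X j \<omega>)) M = pair_pmf (map_pmf (X i) M) (map_pmf (X j) M)"
    using indep_map_pmf[OF assms(1)[unfolded m_dependent_def, rule_format, of j],
        of "\<lambda>x. x i" "\<lambda>x. x j"] assms(3) by simp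
  then have "measure_pmf.expectation (map_pmf (\<lambda>\<omega>. (X i \<omega>, X j \<omega>)) M) (\<lambda>(x, y). x * y)
      = measure_pmf.expectation (map_pmf (X i) M) (\<lambda>x. measure_pmf.expectation (map_pmf (X j) M) (\<lambda>y. x * y))"
    using assms(2) by (simp add: expectation_pair_pmf_finite del: integral_map_pmf)
  then show ?thesis
    by simp
qed

text \<open>A window with j + (m - 1) < a ends within the first a letters, and one with j >= a lies
  in the rest. So the two blocks are functions of the standardized halves, which are
  independent.\<close>

lemma m_dependent_mallows_windows:
  fixes Y :: "nat list \<Rightarrow> real"
  assumes "q > 0" "m \<ge> 1"
  shows "m_dependent (m - 1) (mallows n q)
    (\<lambda>j w. if j + m \<le> length w then Y (st (factor j m w)) else 0)"
  unfolding m_dependent_def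
proof
  fix a
  define X where "X j w = (if j + m \<le> length w then Y (st (factor j m w)) else 0)" for j w
  \<comment> \<open>Cuts beyond the end are clipped to n. Windows that do not fit have value 0 both
    in the whole word and in its halves.\<close>
  define c where "c = min a n"
  let ?M = "mallows n q"
  have split: "map_pmf (\<lambda>w. (st (take c w), st (drop c w))) ?M
      = pair_pmf (map_pmf (\<lambda>w. st (take c w)) ?M) (map_pmf (\<lambda>w. st (drop c w)) ?M)"
  proof -
    have *: "map_pmf (\<lambda>w. (st (take c w), st (drop c w))) ?M
        = pair_pmf (mallows c q) (mallows (n - c) q)"
      using map_pmf_split_mallows[OF assms(1), of c "n - c"] by (simp add: c_def)
    have "map_pmf (\<lambda>w. st (take c w)) ?M = mallows c q"
      "map_pmf (\<lambda>w. st (drop c w)) ?M = mallows (n - c) q"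
      using arg_cong[OF *, of "map_pmf fst"] arg_cong[OF *, of "map_pmf snd"]
      by (simp_all add: map_pmf_comp map_fst_pair_pmf map_snd_pair_pmf)
    with * show ?thesis
      by simp
  qed
  define f where "f u = (\<lambda>j. if j + (m - 1) < a then X j u else 0)" for u
  define g where "g v = (\<lambda>j. if j < a then 0 else X (j - c) v)" for v
  have f: "f (st (take c w)) = (\<lambda>j. if j + (m - 1) < a then X j w else 0)" if "w \<in> set_pmf ?M" for w
  proof
    fix j
    have w: "distinct w" "length w = n"
      using that assms(1) by (auto simp: set_mallows length_Sym dest: permutations_of_setD)
    have "X j (st (take c w)) = X j w" if "j + (m - 1) < a"
    proof (cases "j + m \<le> n")
      case True
      then have "j + m \<le> c"
        using that assms(2) by (simp add: c_def)
      then show ?thesis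
        using w True factor_factor[of j m c 0 w]
        by (simp add: X_def st_factor_st take_eq_factor[of c] length_factor distinct_factor)
    next
      case False
      then show ?thesis
        using w by (simp add: X_def c_def)
    qed
    then show "f (st (take c w)) j = (if j + (m - 1) < a then X j w else 0)"
      by (simp add: f_def)
  qed
  have g: "g (st (drop c w)) = (\<lambda>j. if j < a then 0 else X j w)" if "w \<in> set_pmf ?M" for w
  proof
    fix j
    have w: "distinct w" "length w = n"
      using that assms(1) by (auto simp: set_mallows length_Sym dest: permutations_of_setD)
    have "X (j - c) (st (drop c w)) = X j w" if "\<not> j < a"
    proof -
      have "factor (j - c) m (drop c w) = factor j m w"
        using that by (simp add: factor_def c_def)
      then show ?thesis
        using w that assms(2) by (auto simp: X_def st_factor_st c_def)
    qed
    then show "g (st (drop c w)) j = (if j < a then 0 else X j w)"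
      by (simp add: g_def)
  qed
  have "map_pmf (\<lambda>w. (f (st (take c w)), g (st (drop c w)))) ?M
      = pair_pmf (map_pmf (\<lambda>w. f (st (take c w))) ?M) (map_pmf (\<lambda>w. g (st (drop c w))) ?M)"
    by (rule indep_map_pmf[OF split])
  moreover have "map_pmf (\<lambda>w. (f (st (take c w)), g (st (drop c w)))) ?M
      = map_pmf (\<lambda>w. ((\<lambda>j. if j + (m - 1) < a then X j w else 0), (\<lambda>j. if j < a then 0 else X j w))) ?M"
    by (rule map_pmf_cong) (simp_all only: f g)
  moreover have "map_pmf (\<lambda>w. f (st (take c w))) ?M
      = map_pmf (\<lambda>w j. if j + (m - 1) < a then X j w else 0) ?M"
    by (rule map_pmf_cong) (simp_all only: f)
  moreover have "map_pmf (\<lambda>w. g (st (drop c w))) ?M = map_pmf (\<lambda>w j. if j < a then 0 else X j w) ?M"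
    by (rule map_pmf_cong) (simp_all only: g)
  ultimately show "map_pmf (\<lambda>w. (\<lambda>j. if j + (m - 1) < a
        then if j + m \<le> length w then Y (st (factor j m w)) else 0 else 0,
        \<lambda>j. if j < a then 0 else if j + m \<le> length w then Y (st (factor j m w)) else 0)) ?M
      = pair_pmf (map_pmf (\<lambda>w j. if j + (m - 1) < a
        then if j + m \<le> length w then Y (st (factor j m w)) else 0 else 0) ?M)
       (map_pmf (\<lambda>w j. if j < a then 0 else if j + m \<le> length w then Y (st (factor j m w)) else 0) ?M)"
    by (simp only: X_def)
qed

section \<open>Moments of the number of occurrences\<close>

text \<open>\<open>i - j + (j - i)\<close> is the distance |i - j| in truncated subtraction. The
  term k = N has coefficient 0 and is kept so that the induction step adds exactly one
  \<open>c k\<close> for every k up to N.\<close>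

lemma toeplitz_sum:
  fixes c :: "nat \<Rightarrow> real"
  shows "(\<Sum>i<N. \<Sum>j<N. c (i - j + (j - i))) = real N * c 0 + 2 * (\<Sum>k=1..N. (real N - real k) * c k)"
proof (induction N)
  case (Suc N)
  have row: "(\<Sum>i<N. c (N - i)) = (\<Sum>k=1..N. c k)"
    by (rule sum.reindex_bij_witness[of _ "\<lambda>k. N - k" "\<lambda>i. N - i"]) auto
  have "(\<Sum>i<Suc N. \<Sum>j<Suc N. c (i - j + (j - i)))
      = (\<Sum>i<N. \<Sum>j<N. c (i - j + (j - i))) + (\<Sum>i<N. c (N - i)) + (\<Sum>j<N. c (N - j)) + c 0"
    by (simp add: sum.distrib)
  also have "\<dots> = real N * c 0 + 2 * (\<Sum>k=1..N. (real N - real k) * c k) + 2 * (\<Sum>k=1..N. c k) + c 0"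
    unfolding Suc.IH row by simp
  also have "\<dots> = real (Suc N) * c 0 + 2 * (\<Sum>k=1..N. (real N - real k) * c k + c k)"
    by (simp add: sum.distrib distrib_left distrib_right)
  also have "(\<Sum>k=1..N. (real N - real k) * c k + c k) = (\<Sum>k=1..Suc N. (real (Suc N) - real k) * c k)"
    by (simp add: algebra_simps)
  finally show ?case .
qed simp

text \<open>If \<sigma> starts with an ascent, the decreasing permutation avoids it, and otherwise
  the increasing one does. It serves to show that the variance is not zero.\<close>

lemma ex_Sym_avoiding:
  assumes "\<sigma> \<in> Sym m" "m \<ge> 2"
  shows "\<exists>w\<in>Sym n. \<forall>j. j + m \<le> n \<longrightarrow> st (factor j m w) \<noteq> \<sigma>"
proof -
  have neq: "\<sigma> ! 0 \<noteq> \<sigma> ! 1"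
    using assms permutations_of_setD[OF assms(1)] length_Sym[OF assms(1)]
    by (simp add: nth_eq_iff_index_eq)
  have iff: "\<sigma> ! 0 < \<sigma> ! 1 \<longleftrightarrow> w ! j < w ! Suc j"
    if "j + m \<le> n" "length w = n" "st (factor j m w) = \<sigma>" for w j
    using st_order_iso[of 0 "factor j m w" 1] that assms(2) nth_factor[of _ j m w]
    by (simp add: length_factor)
  show ?thesis
  proof (cases "\<sigma> ! 0 < \<sigma> ! 1")
    case True
    have "rev [1..<Suc n] \<in> Sym n"
      by (auto simp: permutations_of_set_def simp del: upt_Suc)
    moreover have "st (factor j m (rev [1..<Suc n])) \<noteq> \<sigma>" if "j + m \<le> n" for j
      using iff[of j "rev [1..<Suc n]"] True that assms(2) by (auto simp: rev_nth simp del: upt_Suc)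
    ultimately show ?thesis
      by blast
  next
    case False
    have "[1..<Suc n] \<in> Sym n"
      by (auto simp: permutations_of_set_def simp del: upt_Suc)
    moreover have "st (factor j m [1..<Suc n]) \<noteq> \<sigma>" if "j + m \<le> n" for j
      using iff[of j "[1..<Suc n]"] False that assms(2) by (auto simp del: upt_Suc)
    ultimately show ?thesis
      by blast
  qed
qed

lemma expectation_window:
  fixes h :: "nat list \<Rightarrow> real"
  assumes "q > 0" "j + k \<le> n"
  shows "measure_pmf.expectation (mallows n q) (\<lambda>w. h (st (factor j k w)))
    = measure_pmf.expectation (mallows k q) h"
  using arg_cong[OF map_pmf_st_factor_mallows[OF assms], of "\<lambda>p. measure_pmf.expectation p h"]
  by simp

lemma expectation_mallows:
  fixes h :: "nat list \<Rightarrow> real"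
  assumes "q > 0"
  shows "measure_pmf.expectation (mallows k q) h = (\<Sum>w\<in>Sym k. h w * (q ^ inversions w / qfact q k))"
  using assms by (subst integral_measure_pmf_real[where A = "Sym k"]) (auto simp: set_mallows pmf_mallows)

section \<open>Occurrence indicators and their covariances\<close>

locale mallows_pattern =
  fixes m n :: nat and \<sigma> :: "nat list" and q :: real
  assumes m: "m \<ge> 2" and \<sigma>: "\<sigma> \<in> Sym m" and q: "q > 0" and n: "n \<ge> 2 * m - 1"
begin

abbreviation E :: "(nat list \<Rightarrow> real) \<Rightarrow> real" where
  "E \<equiv> measure_pmf.expectation (mallows n q)"

definition N :: nat where
  "N = n + 1 - m"

definition occ :: "nat \<Rightarrow> nat list \<Rightarrow> real" where
  "occ j w = (if j + m \<le> length w then of_bool (st (factor j m w) = \<sigma>) else 0)"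

lemma length_\<sigma> [simp]: "length \<sigma> = m"
  using \<sigma> by (rule length_Sym)

lemma less_N_iff: "j < N \<longleftrightarrow> j + m \<le> n"
  using m n by (auto simp: N_def)

lemma real_N: "real N = real n - real m + 1"
  using m n by (simp add: N_def of_nat_diff)

lemma finite_support: "finite (set_pmf (mallows n q))"
  using q by (simp add: set_mallows)

lemma int [simp, intro]: "integrable (measure_pmf (mallows n q)) (f :: _ \<Rightarrow> real)"
  using finite_support by (rule integrable_measure_pmf_finite)

lemma E_cong: "(\<And>w. w \<in> Sym n \<Longrightarrow> f w = g w) \<Longrightarrow> E f = E g"
  using q by (simp add: expectation_mallows)

lemma mu_pos: "mu \<sigma> q > 0"
  using q qfact_pos[OF q] by (simp add: mu_def)

lemma mu_le_1: "mu \<sigma> q \<le> 1"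
  using pmf_le_1[of "mallows m q" \<sigma>] q \<sigma> by (simp add: pmf_mallows mu_def)

lemma E_occ: "j < N \<Longrightarrow> E (occ j) = mu \<sigma> q"
proof -
  assume j: "j < N"
  have "E (occ j) = E (\<lambda>w. of_bool (st (factor j m w) = \<sigma>))"
    using j by (intro E_cong) (simp add: occ_def length_Sym less_N_iff)
  also have "\<dots> = measure_pmf.expectation (mallows m q) (\<lambda>v. of_bool (v = \<sigma>))"
    using j q by (intro expectation_window) (simp_all add: less_N_iff)
  also have "\<dots> = (\<Sum>v\<in>Sym m. if v = \<sigma> then q ^ inversions v / qfact q m else 0)"
    unfolding expectation_mallows[OF q] by (rule sum.cong) auto
  also have "\<dots> = mu \<sigma> q"
    using \<sigma> by (simp add: mu_def)
  finally show ?thesis .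
qed

lemma occ_mult_self: "occ j w * occ j w = occ j w"
  by (simp add: occ_def)

text \<open>Windows at distance k < m share m - k letters, which is the overlap index of
  \<open>T\<close>. From distance m on the value is 0.\<close>

definition cov :: "nat \<Rightarrow> real" where
  "cov k = (if k = 0 then mu \<sigma> q else if k < m then T (m - k) \<sigma> q else (mu \<sigma> q)\<^sup>2) - (mu \<sigma> q)\<^sup>2"

text \<open>At distance 0 the indicator is idempotent. For 0 < k < m both windows lie in one window
  of length m + k, and both match exactly if its pattern lies in the overlap set. Windows at
  distance at least m are disjoint, hence independent.\<close>

lemma E_occ_mult_shift:
  assumes "i + k < N"
  shows "E (\<lambda>w. occ i w * occ (i + k) w) = cov k + (mu \<sigma> q)\<^sup>2"
proof -
  consider "k = 0" | "0 < k" "k < m" | "m \<le> k"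
    by linarith
  then show ?thesis
  proof cases
    case 1
    then show ?thesis
      using E_occ[of i] assms by (simp add: occ_mult_self cov_def)
  next
    case 2
    \<comment> \<open>The length m + k, in the shape used by \<open>Ov\<close> and \<open>T\<close>
      with s = m - k.\<close>
    let ?l = "2 * m - (m - k)"
    have l: "?l = m + k"
      using 2 by simp
    have "E (\<lambda>w. occ i w * occ (i + k) w) = E (\<lambda>w. of_bool (st (factor i ?l w) \<in> Ov (m - k) \<sigma>))"
    proof (rule E_cong)
      fix w assume w: "w \<in> Sym n"
      let ?u = "factor i ?l w"
      have u: "distinct ?u" "length ?u = ?l"
        using w assms permutations_of_setD[OF w]
        by (auto simp: distinct_factor length_factor length_Sym[OF w] less_N_iff l)
      have "factor 0 m ?u = factor i m w" "factor k m ?u = factor (i + k) m w"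
        using factor_factor[of 0 m ?l i w] factor_factor[of k m ?l i w] l by simp_all
      then show "occ i w * occ (i + k) w = of_bool (st ?u \<in> Ov (m - k) \<sigma>)"
        using assms 2 u length_Sym[OF w] st_in_Sym[of ?u]
        by (auto simp: occ_def Ov_def st_factor_st less_N_iff)
    qed
    also have "\<dots> = measure_pmf.expectation (mallows ?l q) (\<lambda>v. of_bool (v \<in> Ov (m - k) \<sigma>))"
      using assms q by (intro expectation_window) (simp_all add: less_N_iff l)
    also have "\<dots> = (\<Sum>v\<in>Sym ?l. if v \<in> Ov (m - k) \<sigma> then q ^ inversions v / qfact q ?l else 0)"
      unfolding expectation_mallows[OF q] by (rule sum.cong) auto
    also have "\<dots> = (\<Sum>v\<in>Ov (m - k) \<sigma>. q ^ inversions v / qfact q ?l)"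
      by (intro sum.mono_neutral_cong_right) (auto simp: Ov_def)
    also have "\<dots> = T (m - k) \<sigma> q"
      by (simp add: T_def)
    finally show ?thesis
      using 2 by (simp add: cov_def)
  next
    case 3
    have "E (\<lambda>w. occ i w * occ (i + k) w) = E (occ i) * E (occ (i + k))"
    proof (rule m_dependent_mult_expectation)
      show "m_dependent (m - 1) (mallows n q) occ"
        unfolding occ_def [abs_def]
        using m q by (intro m_dependent_mallows_windows[where Y = "\<lambda>v. of_bool (v = \<sigma>)"]) auto
    qed (use finite_support m 3 in auto)
    then show ?thesis
      using 3 m assms E_occ[of i] E_occ[of "i + k"] by (simp add: cov_def power2_eq_square)
  qed
qed

lemma variance_eq: "E (\<lambda>w. (\<Sum>i<N. occ i w - mu \<sigma> q)\<^sup>2) = b_sq n \<sigma> q"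
proof -
  let ?\<mu> = "mu \<sigma> q"
  have prod: "E (\<lambda>w. (occ i w - ?\<mu>) * (occ j w - ?\<mu>)) = cov (i - j + (j - i))"
    if "i < N" "j < N" for i j
  proof -
    have "E (\<lambda>w. occ i w * occ j w) = cov (i - j + (j - i)) + ?\<mu>\<^sup>2"
    proof (cases "i \<le> j")
      case True
      then show ?thesis
        using E_occ_mult_shift[of i "j - i"] that by simp
    next
      case False
      then show ?thesis
        using E_occ_mult_shift[of j "i - j"] that by (simp add: mult.commute)
    qed
    then show ?thesis
      using E_occ[OF that(1)] E_occ[OF that(2)]
      by (simp add: left_diff_distrib right_diff_distrib power2_eq_square)
  qed
  \<comment> \<open>This is where the lower bound on n enters: all distances 1 to m - 1 occur among
    the windows, and larger ones contribute nothing.\<close>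
  have mN: "m \<le> N"
    using m n by (simp add: N_def)
  have "E (\<lambda>w. (\<Sum>i<N. occ i w - ?\<mu>)\<^sup>2)
      = (\<Sum>i<N. \<Sum>j<N. E (\<lambda>w. (occ i w - ?\<mu>) * (occ j w - ?\<mu>)))"
    by (simp add: power2_eq_square sum_product)
  also have "\<dots> = (\<Sum>i<N. \<Sum>j<N. cov (i - j + (j - i)))"
    by (intro sum.cong refl prod) auto
  also have "\<dots> = real N * cov 0 + 2 * (\<Sum>k=1..N. (real N - real k) * cov k)"
    by (rule toeplitz_sum)
  also have "(\<Sum>k=1..N. (real N - real k) * cov k) = (\<Sum>k=1..m - 1. (real N - real k) * cov k)"
    using mN m by (intro sum.mono_neutral_right) (auto simp: cov_def)
  \<comment> \<open>The substitution s = m - k turns distances into overlaps: N - k = n - 2m + 1 +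
    s.\<close>
  also have "\<dots> = (\<Sum>s=1..m - 1. (real n - 2 * real m + 1 + real s) * (T s \<sigma> q - ?\<mu>\<^sup>2))"
    by (rule sum.reindex_bij_witness[of _ "\<lambda>s. m - s" "\<lambda>k. m - k"])
      (auto simp: cov_def real_N of_nat_diff)
  also have "cov 0 = ?\<mu> * (1 - ?\<mu>)"
    by (simp add: cov_def algebra_simps power2_eq_square)
  finally show ?thesis
    by (simp add: b_sq_def Let_def real_N algebra_simps)
qed

text \<open>A permutation avoiding \<sigma> has positive probability, and there the centred sum is
  -N \<mu>, which is not 0.\<close>

lemma b_sq_pos: "b_sq n \<sigma> q > 0"
proof -
  obtain w where w: "w \<in> Sym n" "\<forall>j. j + m \<le> n \<longrightarrow> st (factor j m w) \<noteq> \<sigma>"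
    using ex_Sym_avoiding[OF \<sigma> m] by blast
  let ?f = "\<lambda>w. (\<Sum>i<N. occ i w - mu \<sigma> q)\<^sup>2"
  have "(\<Sum>i<N. occ i w - mu \<sigma> q) = (\<Sum>i<N. - mu \<sigma> q)"
    using w by (intro sum.cong refl) (auto simp: occ_def less_N_iff length_Sym)
  then have "?f w > 0"
    using mu_pos m n by (simp add: N_def)
  then have "0 < (\<Sum>v\<in>Sym n. ?f v * (q ^ inversions v / qfact q n))"
    using w q qfact_pos[OF q, of n] by (intro sum_pos2[of _ w]) auto
  then show ?thesis
    using q by (simp add: expectation_mallows flip: variance_eq)
qed

lemma b_dev_pos: "b_dev n \<sigma> q > 0"
  using b_sq_pos by (simp add: b_dev_def)

section \<open>Reduction to the normalized sum\<close>

lemma occurrences_eq: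
  assumes "w \<in> Sym n"
  shows "real (occurrences \<sigma> w) = (\<Sum>i<N. occ i w)"
proof -
  have "{j. j + length \<sigma> \<le> length w \<and> st (factor j (length \<sigma>) w) = \<sigma>}
      = {j \<in> {..<N}. st (factor j m w) = \<sigma>}"
    by (simp add: length_Sym[OF assms] less_N_iff Collect_conj_eq)
  then have "real (occurrences \<sigma> w) = (\<Sum>j | j \<in> {..<N} \<and> st (factor j m w) = \<sigma>. 1)"
    by (simp add: occurrences_def)
  also have "\<dots> = (\<Sum>i<N. occ i w)"
    by (intro sum.mono_neutral_cong_left) (auto simp: occ_def less_N_iff length_Sym[OF assms])
  finally show ?thesis .
qed

text \<open>The centring stands inside the conditional, so that each \<open>X j\<close> is a
  function of one window and \<open>m_dependent_mallows_windows\<close> applies directly.\<close>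

definition X :: "nat \<Rightarrow> nat list \<Rightarrow> real" where
  "X j w = (if j + m \<le> length w
     then (of_bool (st (factor j m w) = \<sigma>) - mu \<sigma> q) / b_dev n \<sigma> q else 0)"

lemma X_eq: "w \<in> Sym n \<Longrightarrow> j < N \<Longrightarrow> X j w = (occ j w - mu \<sigma> q) / b_dev n \<sigma> q"
  by (simp add: X_def occ_def length_Sym less_N_iff)

lemma sum_X_eq: "w \<in> Sym n \<Longrightarrow> (\<Sum>i<N. X i w) = (\<Sum>i<N. occ i w - mu \<sigma> q) / b_dev n \<sigma> q"
  by (simp add: X_eq sum_divide_distrib)

lemma E_X_sq: "j < N \<Longrightarrow> E (\<lambda>w. (X j w)\<^sup>2) = mu \<sigma> q * (1 - mu \<sigma> q) / (b_dev n \<sigma> q)\<^sup>2"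
proof -
  assume j: "j < N"
  have "E (\<lambda>w. (X j w)\<^sup>2) = E (\<lambda>w. (occ j w - 2 * mu \<sigma> q * occ j w + (mu \<sigma> q)\<^sup>2) / (b_dev n \<sigma> q)\<^sup>2)"
    using j by (intro E_cong)
      (simp add: X_eq power_divide power2_diff power2_eq_square[of "occ j _"] occ_mult_self)
  also have "\<dots> = mu \<sigma> q * (1 - mu \<sigma> q) / (b_dev n \<sigma> q)\<^sup>2"
    using E_occ[OF j] by (simp add: algebra_simps power2_eq_square)
  finally show ?thesis .
qed

sublocale S: m_dependent_sum "mallows n q" X N "m - 1" "1 / b_dev n \<sigma> q"
proof
  show "finite (set_pmf (mallows n q))"
    by (rule finite_support)
  show "m_dependent (m - 1) (mallows n q) X"
    unfolding X_def [abs_def]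
    using m q by (intro m_dependent_mallows_windows[where
          Y = "\<lambda>v. (of_bool (v = \<sigma>) - mu \<sigma> q) / b_dev n \<sigma> q"]) auto
  show "E (X i) = 0" if "i < N" for i
  proof -
    have "E (X i) = E (\<lambda>w. (occ i w - mu \<sigma> q) / b_dev n \<sigma> q)"
      using that by (intro E_cong X_eq)
    then show ?thesis
      using E_occ[OF that] by simp
  qed
  show "\<bar>X i w\<bar> \<le> 1 / b_dev n \<sigma> q" for i w
    using b_dev_pos mu_pos mu_le_1 by (auto simp: X_def abs_divide intro!: divide_right_mono)
  have "E (\<lambda>w. (\<Sum>i<N. X i w)\<^sup>2) = E (\<lambda>w. (\<Sum>i<N. occ i w - mu \<sigma> q)\<^sup>2 / (b_dev n \<sigma> q)\<^sup>2)"
    by (intro E_cong) (simp add: sum_X_eq power_divide)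
  also have "\<dots> = b_sq n \<sigma> q / (b_dev n \<sigma> q)\<^sup>2"
    by (simp add: variance_eq)
  also have "\<dots> = 1"
    using b_sq_pos by (simp add: b_dev_def)
  finally show "E (\<lambda>w. (\<Sum>i<N. X i w)\<^sup>2) = 1" .
qed

lemma prob_occurrences_eq:
  "measure_pmf.prob (mallows n q) {\<pi>. real (occurrences \<sigma> \<pi>) \<le> k}
   = measure_pmf.prob (mallows n q) {\<pi>. (\<Sum>i<N. X i \<pi>) \<le> (k - a_mean n \<sigma> q) / b_dev n \<sigma> q}"
proof -
  have "{\<pi>. real (occurrences \<sigma> \<pi>) \<le> k} \<inter> set_pmf (mallows n q)
      = {\<pi>. (\<Sum>i<N. X i \<pi>) \<le> (k - a_mean n \<sigma> q) / b_dev n \<sigma> q} \<inter> set_pmf (mallows n q)"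
    using b_dev_pos q
    by (auto simp: set_mallows occurrences_eq sum_X_eq sum_subtractf a_mean_def real_N divide_le_cancel)
  then show ?thesis
    by (metis measure_Int_set_pmf)
qed

text \<open>With A = 1/b and second moments \<mu>(1 - \<mu>)/b^2 the general bound is 28 (2m - 1)^2
  N \<mu>(1 - \<mu>)/b^3. The numerator of \<open>theta\<close> is the third absolute central moment
  \<mu>(1 - \<mu>)((1 - \<mu>)^2 + \<mu>^2) of an indicator. The last factor is at least 1/2, so it
  remains to compare 28 (2m - 1)^2 with half the stated constant.\<close>

lemma normal_approximation:
  "\<bar>measure_pmf.prob (mallows n q) {\<pi>. real (occurrences \<sigma> \<pi>) \<le> k}
     - cdf std_normal_distribution ((k - a_mean n \<sigma> q) / b_dev n \<sigma> q)\<bar>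
   \<le> 75 * (10 * (real m - 1) + 1)\<^sup>2 * (real n - real m + 1) * theta n \<sigma> q"
proof -
  let ?\<mu> = "mu \<sigma> q" and ?b = "b_dev n \<sigma> q"
  let ?D = "2 * (real m - 1) + 1" and ?C = "10 * (real m - 1) + 1"
  have D: "2 * real (m - 1) + 1 = ?D"
    using m by (simp add: of_nat_diff)
  have "?D\<^sup>2 \<le> ?C\<^sup>2"
    using m by (intro power_mono) auto
  then have "28 * ?D\<^sup>2 \<le> 75 / 2 * ?C\<^sup>2"
    using zero_le_power2[of ?C] by linarith
  then have "28 * ?D\<^sup>2 * (real N * (?\<mu> * (1 - ?\<mu>)) / ?b ^ 3)
      \<le> 75 / 2 * ?C\<^sup>2 * (real N * (?\<mu> * (1 - ?\<mu>)) / ?b ^ 3)"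
    using mu_pos mu_le_1 b_dev_pos by (intro mult_right_mono) auto
  also have "\<dots> = 75 * ?C\<^sup>2 * real N * ((?\<mu> * (1 - ?\<mu>) * (1 / 2)) / ?b ^ 3)"
    by simp
  also have "\<dots> \<le> 75 * ?C\<^sup>2 * real N * ((?\<mu> * (1 - ?\<mu>) * ((1 - ?\<mu>)\<^sup>2 + ?\<mu>\<^sup>2)) / ?b ^ 3)"
  proof -
    \<comment> \<open>(1 - \<mu>)^2 + \<mu>^2 equals 1/2 + (1 - 2\<mu>)^2 / 2.\<close>
    have "0 \<le> (1 - 2 * ?\<mu>)\<^sup>2"
      by simp
    then have "1 / 2 \<le> (1 - ?\<mu>)\<^sup>2 + ?\<mu>\<^sup>2"
      by (simp add: power2_eq_square algebra_simps)
    then show ?thesis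
      using mu_pos mu_le_1 b_dev_pos by (intro mult_left_mono divide_right_mono) auto
  qed
  also have "(?\<mu> * (1 - ?\<mu>) * ((1 - ?\<mu>)\<^sup>2 + ?\<mu>\<^sup>2)) / ?b ^ 3 = theta n \<sigma> q"
    by (simp add: theta_def power2_eq_square power3_eq_cube algebra_simps)
  finally have bound: "28 * ?D\<^sup>2 * (real N * (?\<mu> * (1 - ?\<mu>)) / ?b ^ 3)
      \<le> 75 * ?C\<^sup>2 * real N * theta n \<sigma> q" .
  have "(\<Sum>i<N. E (\<lambda>w. (X i w)\<^sup>2)) = real N * (?\<mu> * (1 - ?\<mu>) / ?b\<^sup>2)"
    by (simp add: E_X_sq)
  then have "28 * ((2 * real (m - 1) + 1)\<^sup>2 * (\<Sum>i<N. E (\<lambda>w. (X i w)\<^sup>2)) * (1 / ?b))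
      = 28 * ?D\<^sup>2 * (real N * (?\<mu> * (1 - ?\<mu>)) / ?b ^ 3)"
    unfolding D by (simp add: power2_eq_square power3_eq_cube)
  then show ?thesis
    using S.berry_esseen[of "(k - a_mean n \<sigma> q) / ?b"] bound
    unfolding prob_occurrences_eq by (simp only: real_N)
qed

end

theorem theorem8p1:
  fixes m n :: nat and \<sigma> :: "nat list" and q :: real
  assumes "m \<ge> 3" and "\<sigma> \<in> Sym m" and "q > 0" and "n \<ge> 2 * m - 1"
  shows "(SUP k::real.
            \<bar>measure_pmf.prob (mallows n q) {\<pi>. real (occurrences \<sigma> \<pi>) \<le> k}
             - cdf std_normal_distribution ((k - a_mean n \<sigma> q) / b_dev n \<sigma> q)\<bar>)
         \<le> 75 * (10 * (real m - 1) + 1)\<^sup>2 * (real n - real m + 1) * theta n \<sigma> q"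
proof -
  interpret mallows_pattern m n \<sigma> q
    using assms by unfold_locales auto
  show ?thesis
    by (rule cSUP_least) (use normal_approximation in blast)+
qed

end
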